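(* For each integer $k>1$ let $j(\alpha^k)=k-1$ and $j(\alpha^{i-1})=i$ for $i=k-1,\ldots,1$. Then: (A) each column $\alpha^{i-1}$ in $\mathrm{CAT}(k)$, for $i\in\{1,\ldots,k-1\}\cup\{k+1\}$, preserves the respective $j(\alpha^{i-1})$-th entry of $\alpha$; that is, for every $k$-germ $\alpha$, the entries of $\alpha$ and of $\alpha^{i-1}$ at position $j(\alpha^{i-1})$ are equal; (B) the columns $\alpha^k$ of all the tables $\mathrm{CAT}(k)$, $k>1$, coincide into one sequence of restricted-growth strings and thus into one integer sequence $\mathcal{S}_0$ (that is, for each $k$ the column $\alpha^k$ of $\mathrm{CAT}(k)$, written via indices in the natural enumeration, consists of the first $C_k$ terms of $\mathcal{S}_0$), and for each $k$ the first $C_k$ terms of $\mathcal{S}_0$ form a permutation of $\{0,\ldots,C_k-1\}$ whose square is the identity; (C) let $\mathcal{S}_1$ be the integer sequence given by concatenating the parts with row indices $m$ in the intervals $[0,2),[2,5),\ldots,[C_{k-1},C_k),\ldots$ of the columns $\alpha^{k-1}$ of the corresponding tables $\mathrm{CAT}(2),\mathrm{CAT}(3),\ldots,\mathrm{CAT}(k),\ldots$; then $\mathcal{S}_1$ encodes all the columns $\alpha^{k-1}$, in the sense that for each $k>2$ the whole column $\alpha^{k-1}$ of $\mathrm{CAT}(k)$ is determined, as a permutation of $\{0,\ldots,C_k-1\}$ whose square is the identity, by its part with $m\in[C_{k-1},C_k)$ (for $k=2$ the part $[0,2)$ is the whole column); (D) for each $k>1$, the column $\alpha^{k-1}$ of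 $\mathrm{CAT}(k)$ gives a permutation of $\{0,\ldots,C_k-1\}$ whose square is the identity, and this permutation equals the one given by the rows $m\in[0,C_k)$ of the column $\alpha^{k-1}$ of $\mathrm{CAT}(k+1)$.
   Context: $k$-germs. For $k>1$, a $k$-germ is a $(k-1)$-string $\alpha=a_{k-1}a_{k-2}\cdots a_1$ of nonnegative integers with $a_{k-1}\in\{0,1\}$ and $0\le a_{i-1}\le a_i+1$ for $1<i<k$; $a_j$ is the entry at position $j$. There are $C_k=\frac{(2k)!}{k!(k+1)!}$ $k$-germs. They are ordered lexicographically from the left ($\alpha<\beta$ iff at the leftmost position where they differ the entry of $\alpha$ is smaller); the natural enumeration writes them as $\alpha(0)<\alpha(1)<\cdots<\alpha(C_k-1)$. Prefixing a $0$ to a $k$-germ gives a $(k+1)$-germ with the same index $m$. Stripping the leading zeros of a $k$-germ (keeping $0$ for the null germ) gives its restricted-growth string (RGS). $F$. For $\alpha\ne0^{k-1}$ with rightmost nonzero entry $a_i$, $\beta(\alpha)$ is obtained from $\alpha$ by replacing $a_i$ by $a_i-1$. $F(\alpha)$ is the string of length $n=2k+1$ with entries $0,1,\ldots,k$ (once each) and $k$ asterisks defined by: $F(0^{k-1})=01\cdots k*\cdots*$; if $\alpha\ne 0^{k-1}$ has rightmost nonzero entry $a_i$, write $F(\beta(\alpha))=W|X|Y|Z$ with $W,Z$ its initial and terminal substrings of length $i$, $\Omega$ the first entry of $X$, and $Y$ starting at the entry $\Omega+1$; then $F(\alpha)=W|Y|X|Z$. Let $\theta(\alpha)$ be the binary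 $n$-string obtained from $F(\alpha)$ by replacing each number by $0$ and each asterisk by $1$; every binary $n$-string of weight $k$ is a cyclic translate of $\theta(\alpha)$ for exactly one $k$-germ $\alpha$. Neighbors $\alpha^p$ and tables. For $p\in\{0,1,\ldots,k\}$, $\alpha^p$ is the neighbor of $\alpha$ via color $p$ in the graph $R_k$ (dihedral quotient of the middle-levels graph): change from $0$ to $1$ the entry of $\theta(\alpha)$ at the position where $F(\alpha)$ has the number $p$; take the complemented reversal $b_0\cdots b_{2k}\mapsto\bar b_{2k}\cdots\bar b_0$ of the result, which has weight $k$; $\alpha^p$ is the unique $k$-germ such that this string is a cyclic translate of $\theta(\alpha^p)$. The colored adjacency table $\mathrm{CAT}(k)$ has rows indexed by $m=0,\ldots,C_k-1$ with $\alpha=\alpha(m)$, and columns $\alpha^k,\alpha^{k-1},\ldots,\alpha^0$. A column is regarded as an integer sequence by replacing each $k$-germ by its index in the natural enumeration. *)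

theory Defs
  imports Complex_Main
begin

definition catalan :: "nat \<Rightarrow> nat" where
  "catalan k = fact (2 * k) div (fact k * fact (k + 1))"

section \<open>Germs\<close>

text \<open>
  A k-germ \<open>a\<^bsub>k-1\<^esub> \<dots> a\<^sub>2 a\<^sub>1\<close> is the list \<open>[a\<^bsub>k-1\<^esub>, \<dots>, a\<^sub>2, a\<^sub>1]\<close>. Positions are
  counted from the right, starting at 1.
\<close>

definition entry :: "nat list \<Rightarrow> nat \<Rightarrow> nat" where
  "entry \<alpha> i = \<alpha> ! (length \<alpha> - i)"

definition is_germ :: "nat \<Rightarrow> nat list \<Rightarrow> bool" where
  "is_germ k \<alpha> \<longleftrightarrow> k > 1 \<and> length \<alpha> = k - 1 \<and> entry \<alpha> (k - 1) \<in> {0, 1} \<and>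
     (\<forall>i. 1 < i \<and> i < k \<longrightarrow> entry \<alpha> (i - 1) \<le> entry \<alpha> i + 1)"

text \<open>On lists of equal length, \<open>lex less_than\<close> compares at the leftmost difference.\<close>

definition germ_less :: "nat list \<Rightarrow> nat list \<Rightarrow> bool" where
  "germ_less \<alpha> \<beta> \<longleftrightarrow> (\<alpha>, \<beta>) \<in> lex less_than"

definition germ_index :: "nat \<Rightarrow> nat list \<Rightarrow> nat" where
  "germ_index k \<alpha> = card {\<beta>. is_germ k \<beta> \<and> germ_less \<beta> \<alpha>}"

definition germ_at :: "nat \<Rightarrow> nat \<Rightarrow> nat list" where
  "germ_at k m = (THE \<alpha>. is_germ k \<alpha> \<and> germ_index k \<alpha> = m)"

definition rgs :: "nat list \<Rightarrow> nat list" where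
  "rgs \<alpha> = (if \<alpha> = replicate (length \<alpha>) 0 then [0] else dropWhile (\<lambda>a. a = 0) \<alpha>)"

section \<open>The strings \<open>F(\<alpha>)\<close> and \<open>\<theta>(\<alpha>)\<close>\<close>

definition rightmost_nonzero :: "nat list \<Rightarrow> nat" where
  "rightmost_nonzero \<alpha> = (LEAST i. 1 \<le> i \<and> i \<le> length \<alpha> \<and> entry \<alpha> i \<noteq> 0)"

definition parent :: "nat list \<Rightarrow> nat list" where
  "parent \<alpha> = (let i = rightmost_nonzero \<alpha> in \<alpha>[length \<alpha> - i := entry \<alpha> i - 1])"

lemma sum_list_parent:
  assumes "\<alpha> \<noteq> replicate (length \<alpha>) 0"
  shows "sum_list (parent \<alpha>) < sum_list \<alpha>"
proof -
  let ?P = "\<lambda>i. 1 \<le> i \<and> i \<le> length \<alpha> \<and> entry \<alpha> i \<noteq> 0"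
  from assms obtain q where q: "q < length \<alpha>" "\<alpha> ! q \<noteq> 0"
    by (metis length_replicate nth_equalityI nth_replicate)
  have "?P (length \<alpha> - q)"
    using q by (simp add: entry_def)
  then have P: "?P (rightmost_nonzero \<alpha>)"
    unfolding rightmost_nonzero_def by (rule LeastI)
  let ?q = "length \<alpha> - rightmost_nonzero \<alpha>"
  have lt: "?q < length \<alpha>" and nz: "\<alpha> ! ?q \<noteq> 0"
    using P by (auto simp: entry_def)
  have "\<alpha> ! ?q \<le> sum_list \<alpha>"
    using lt by (simp add: member_le_sum_list)
  then show ?thesis
    using lt nz by (simp add: parent_def Let_def entry_def sum_list_update)
qed

text \<open>
  \<open>Some p\<close> is the number \<open>p\<close>, \<open>None\<close> is an asterisk. In the recursive case
  \<open>F(parent \<alpha>) = W|M|Z\<close> with \<open>W\<close> and \<open>Z\<close> of length \<open>i\<close>, and \<open>M = X|Y\<close> is cut in front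
  of the entry that is one more than the first entry of \<open>M\<close>.
\<close>

function F :: "nat list \<Rightarrow> nat option list" where
  "F \<alpha> =
    (if \<alpha> = replicate (length \<alpha>) 0
     then (let k = length \<alpha> + 1 in map Some [0..<k + 1] @ replicate k None)
     else
       (let i = rightmost_nonzero \<alpha>;
            G = F (parent \<alpha>);
            W = take i G;
            Z = drop (length G - i) G;
            M = take (length G - 2 * i) (drop i G);
            \<Omega> = the (hd M);
            X = takeWhile (\<lambda>x. x \<noteq> Some (\<Omega> + 1)) M;
            Y = dropWhile (\<lambda>x. x \<noteq> Some (\<Omega> + 1)) M
        in W @ Y @ X @ Z))"
  by pat_completeness auto
termination
  by (relation "measure sum_list") (auto intro: sum_list_parent)

declare F.simps [simp del]

text \<open>Binary strings are Boolean lists: \<open>True\<close> is the bit 1, \<open>False\<close> is the bit 0.\<close>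

definition \<theta> :: "nat list \<Rightarrow> bool list" where
  "\<theta> \<alpha> = map (\<lambda>x. x = None) (F \<alpha>)"

definition cyclic_translate :: "'a list \<Rightarrow> 'a list \<Rightarrow> bool" where
  "cyclic_translate u v \<longleftrightarrow> (\<exists>r. u = rotate r v)"

definition complemented_reversal :: "bool list \<Rightarrow> bool list" where
  "complemented_reversal b = rev (map Not b)"

section \<open>Neighbors and the colored adjacency tables\<close>

definition number_position :: "nat list \<Rightarrow> nat \<Rightarrow> nat" where
  "number_position \<alpha> p = (THE q. q < length (F \<alpha>) \<and> F \<alpha> ! q = Some p)"

definition neighbor :: "nat \<Rightarrow> nat list \<Rightarrow> nat \<Rightarrow> nat list" where
  "neighbor k \<alpha> p =
     (THE \<gamma>. is_germ k \<gamma> \<and>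
        cyclic_translate (complemented_reversal ((\<theta> \<alpha>)[number_position \<alpha> p := True])) (\<theta> \<gamma>))"

definition CAT :: "nat \<Rightarrow> nat \<Rightarrow> nat \<Rightarrow> nat list" where
  "CAT k m p = neighbor k (germ_at k m) p"

definition CAT_column :: "nat \<Rightarrow> nat \<Rightarrow> nat \<Rightarrow> nat" where
  "CAT_column k p m = germ_index k (CAT k m p)"

definition j_pos :: "nat \<Rightarrow> nat \<Rightarrow> nat" where
  "j_pos k p = (if p = k then k - 1 else p + 1)"

definition involutive_permutation :: "nat \<Rightarrow> (nat \<Rightarrow> nat) \<Rightarrow> bool" where
  "involutive_permutation N \<sigma> \<longleftrightarrow>
     bij_betw \<sigma> {0..<N} {0..<N} \<and> (\<forall>m<N. \<sigma> (\<sigma> m) = m)"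

text \<open>
  The first row interval is \<open>[0,2)\<close>, not \<open>[catalan 1, catalan 2) = [1,2)\<close>.
\<close>

definition S1_part :: "nat \<Rightarrow> nat list" where
  "S1_part k = map (CAT_column k (k - 1)) [(if k = 2 then 0 else catalan (k - 1))..<catalan k]"

text \<open>The infinite concatenation is given by its finite prefixes.\<close>

definition is_S1 :: "(nat \<Rightarrow> nat) \<Rightarrow> bool" where
  "is_S1 S \<longleftrightarrow> (\<forall>k>1. map S [0..<catalan k] = concat (map S1_part [2..<k + 1]))"

end

theory Submission
  imports Defs "HOL-Library.Multiset"
begin

text \<open>
  Read the bit 0 as an up step and 1 as a down step. Then \<open>\<theta> \<alpha>\<close> is 0 followed by a Dyck word, that is, an
  ordered tree, and the entries of \<open>\<alpha>\<close> are the instructions for building this tree. The number that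
  \<open>F \<alpha>\<close> places on a 0 of \<open>\<theta> \<alpha>\<close> has an invariant meaning: read the cyclic word from just after this 0
  once around; the number counts the up steps below level 0 of this balanced path (the Chung-Feller
  statistic). Passing to the neighbor along a color \<open>p\<close> reverses and complements that path, which
  keeps the statistic, so every color acts as an involution. The positive excursions of the path
  with statistic \<open>p\<close> are the trees present in the construction when the entries
  \<open>a\<^sub>p, \<dots>, a\<^sub>1\<close> are still to be processed; their number \<open>a\<^bsub>p+1\<^esub> + 1\<close> is therefore preserved.
\<close>

text \<open>The cut and paste in \<open>F\<close> is a move of trees: raising the rightmost nonzero
  entry from a-1 to a takes the last child out of the last tree and puts it at the front of the
  forest, which exchanges two adjacent blocks of the word. The exchange keeps the statistic at every
  label. Since the numbers 0, ..., k are distinct, the statistic identifies the 0 from which a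
  cyclic word is read; with the cycle lemma, the neighbor along p becomes the germ whose path for p
  is the complemented reversal of the given one. Colors k and k-1 leave almost no forest. For color
  k the path lies weakly below level 0, and a prefixed 0 only wraps it into a 1 and a 0. For color
  k-1 it contains a single leaf, and a prefixed 0 only replaces the word 01 of this leaf by 0011.
  Both changes commute with complemented reversal, so consecutive tables agree. In column k-1 a
  leading 0 never survives: for k > 2 every row below C_{k-1} is the partner of a row in [C_{k-1},
  C_k), which is why that part determines the column.\<close>

fun hgt :: "bool list \<Rightarrow> int" where
  "hgt [] = 0"
| "hgt (b # w) = (if b then - 1 else 1) + hgt w"

fun flaw :: "int \<Rightarrow> bool list \<Rightarrow> nat" where
  "flaw h [] = 0"
| "flaw h (b # w) = (if \<not> b \<and> h < 0 then 1 else 0) + flaw (h + (if b then - 1 else 1)) w"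

abbreviation ups :: "bool list \<Rightarrow> nat" where
  "ups w \<equiv> count_list w False"

abbreviation cr :: "bool list \<Rightarrow> bool list" where
  "cr \<equiv> complemented_reversal"

lemma hgt_append [simp]: "hgt (u @ v) = hgt u + hgt v"
  by (induction u) auto

lemma flaw_append [simp]: "flaw h (u @ v) = flaw h u + flaw (h + hgt u) v"
  by (induction u arbitrary: h) (auto simp: algebra_simps)

lemma hgt_replicate [simp]: "hgt (replicate n b) = (if b then - int n else int n)"
  by (induction n) auto

lemma flaw_replicate_True [simp]: "flaw h (replicate n True) = 0"
  by (induction n arbitrary: h) auto

lemma flaw_replicate_False_nonneg: "h \<ge> 0 \<Longrightarrow> flaw h (replicate n False) = 0"
  by (induction n arbitrary: h) auto

lemma flaw_replicate_False_neg: "h + int n \<le> 0 \<Longrightarrow> flaw h (replicate n False) = n"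
  by (induction n arbitrary: h) auto

lemma flaw_antimono: "h \<le> h' \<Longrightarrow> flaw h' w \<le> flaw h w"
proof (induction w arbitrary: h h')
  case (Cons b w)
  show ?case using Cons.IH[of "h + (if b then - 1 else 1)" "h' + (if b then - 1 else 1)"] Cons.prems
    by auto
qed simp

lemma flaw_le_ups: "flaw h w \<le> ups w"
  by (induction w arbitrary: h) (auto simp: add_le_mono le_SucI)

lemma cr_Nil [simp]: "cr [] = []"
  and cr_append [simp]: "cr (u @ v) = cr v @ cr u"
  and cr_Cons: "cr (b # v) = cr v @ [\<not> b]"
  and cr_cr [simp]: "cr (cr w) = w"
  and length_cr [simp]: "length (cr w) = length w"
  by (auto simp: complemented_reversal_def rev_map o_def)

lemma hgt_cr [simp]: "hgt (cr w) = - hgt w"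
  by (induction w) (auto simp: cr_Cons)

text \<open>\<open>cr w\<close> is \<open>w\<close> traversed backwards. The correction term is the difference between the
  numbers of up and down steps of \<open>w\<close> below level 0.\<close>

lemma flaw_cr:
  "int (flaw (h + hgt w) (cr w)) = int (flaw h w) + min h 0 - min (h + hgt w) 0"
proof (induction w arbitrary: h)
  case (Cons b w)
  show ?case using Cons.IH[of "h + (if b then - 1 else 1)"]
    by (auto simp: cr_Cons add.assoc) 
qed simp

lemma flaw_cr_balanced: "hgt w = 0 \<Longrightarrow> flaw h (cr w) = flaw h w"
  using flaw_cr[of h w] by simp

lemma ups_hgt: "int (length w) + hgt w = 2 * int (ups w)"
  by (induction w) auto

section \<open>Cyclic translates, as exchanges of two blocks\<close>

definition cyc :: "'a list \<Rightarrow> 'a list \<Rightarrow> bool" where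
  "cyc u v \<longleftrightarrow> (\<exists>x y. v = x @ y \<and> u = y @ x)"

lemma cyclic_translate_iff: "cyclic_translate u v \<longleftrightarrow> cyc u v"
proof
  assume "cyclic_translate u v"
  then show "cyc u v"
    unfolding cyclic_translate_def cyc_def rotate_drop_take
    by (metis append_take_drop_id)
next
  assume "cyc u v"
  then show "cyclic_translate u v"
    unfolding cyclic_translate_def cyc_def by (metis rotate_append)
qed

lemma cyc_refl: "cyc u u"
  unfolding cyc_def by (metis append.right_neutral append_Nil)

lemma cyc_sym: "cyc u v \<Longrightarrow> cyc v u"
  unfolding cyc_def by blast

lemma cyc_trans: "cyc u v \<Longrightarrow> cyc v w \<Longrightarrow> cyc u w"
  unfolding cyclic_translate_iff[symmetric] cyclic_translate_def by (metis rotate_rotate)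

lemma cyc_swap: "cyc (x @ y) (y @ x)"
  unfolding cyc_def by blast

lemma cyc_hgt: "cyc u v \<Longrightarrow> hgt u = hgt v"
  unfolding cyc_def by auto

lemma cyc_length: "cyc u v \<Longrightarrow> length u = length v"
  unfolding cyc_def by auto

section \<open>Forests and their words\<close>

datatype tree = Node "tree list"

fun fw :: "tree list \<Rightarrow> bool list" where
  "fw [] = []"
| "fw (Node a # ts) = False # fw a @ True # fw ts"

lemma fw_append [simp]: "fw (ts @ us) = fw ts @ fw us"
  by (induction ts rule: fw.induct) auto

lemma hgt_fw [simp]: "hgt (fw ts) = 0"
  by (induction ts rule: fw.induct) auto

lemma flaw_fw_nonneg: "h \<ge> 0 \<Longrightarrow> flaw h (fw ts) = 0"
  by (induction ts arbitrary: h rule: fw.induct) auto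

text \<open>From level -1 only the root of each tree steps up below level 0; its subtrees are
  traversed at level 0 or higher. This is how the statistic can count trees.\<close>

lemma flaw_fw_minus_one: "flaw (- 1) (fw ts) = length ts"
  by (induction ts rule: fw.induct) (auto simp: flaw_fw_nonneg)

lemma fw_prefix_nonneg: "fw ts = x @ y \<Longrightarrow> hgt x \<ge> 0"
proof (induction ts arbitrary: x y rule: fw.induct)
  case (2 a ts)
  show ?case
  proof (cases x)
    case (Cons b x')
    then have b: "\<not> b" and e: "fw a @ True # fw ts = x' @ y"
      using "2.prems" by auto
    from e consider (l) us where "fw a = x' @ us" | (r) us where "x' = fw a @ True # us" "fw ts = us @ y"
      | (m) "x' = fw a"
      by (auto simp: append_eq_append_conv2 Cons_eq_append_conv)
    then show ?thesis
    proof cases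
      case l then show ?thesis using "2.IH"(1) b Cons by fastforce
    next
      case r then show ?thesis using "2.IH"(2) b Cons by fastforce
    next
      case m then show ?thesis using b Cons by simp
    qed
  qed simp
qed simp

text \<open>The remainders \<open>x\<close> and \<open>y\<close> are empty or start with a down
  step. This generality makes the induction hypothesis apply to the children of the first tree,
  whose word is followed by the closing 1.\<close>

lemma fw_inj_prefix:
  assumes "fw ts @ x = fw us @ y" "x = [] \<or> hd x" "y = [] \<or> hd y"
  shows "ts = us \<and> x = y"
  using assms
proof (induction ts arbitrary: x y us rule: fw.induct)
  case 1
  then show ?case by (cases us rule: fw.cases) auto
next
  case (2 a ts)
  obtain b us' where us: "us = Node b # us'"
    using "2.prems" by (cases us rule: fw.cases) auto
  have e: "fw a @ (True # fw ts @ x) = fw b @ (True # fw us' @ y)"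
    using "2.prems"(1) us by simp
  have "a = b" "True # fw ts @ x = True # fw us' @ y"
    using "2.IH"(1)[OF e] by auto
  then show ?case using "2.IH"(2)[of x us' y] "2.prems" us by simp
qed

lemma fw_inj: "fw ts = fw us \<Longrightarrow> ts = us"
  using fw_inj_prefix[of ts "[]" us "[]"] by simp

lemma fw_insert_peak: "fw ts = x @ y \<Longrightarrow> \<exists>us. fw us = x @ False # True # y"
proof (induction ts arbitrary: x y rule: fw.induct)
  case 1
  then show ?case by (auto intro: exI[of _ "[Node []]"])
next
  case (2 a ts)
  show ?case
  proof (cases x)
    case Nil
    then have "fw (Node [] # Node a # ts) = x @ False # True # y" using "2.prems" by simp
    then show ?thesis by blast
  next
    case (Cons b x')
    then have b: "\<not> b" and e: "fw a @ True # fw ts = x' @ y"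
      using "2.prems" by auto
    from e consider (l) us where "fw a = x' @ us" "y = us @ True # fw ts"
      | (r) us where "x' = fw a @ True # us" "fw ts = us @ y"
      by (auto simp: append_eq_append_conv2 Cons_eq_append_conv)
    then show ?thesis
    proof cases
      case l
      then obtain us' where "fw us' = x' @ False # True # us" using "2.IH"(1) by blast
      then have "fw (Node us' # ts) = x @ False # True # y" using l b Cons by simp
      then show ?thesis by blast
    next
      case r
      then obtain us' where "fw us' = us @ False # True # y" using "2.IH"(2) by blast
      then have "fw (Node a # us') = x @ False # True # y" using r b Cons by simp
      then show ?thesis by blast
    qed
  qed
qed

section \<open>The cycle lemma\<close>

text \<open>A proper rotation would cut both words in front of a 0. The two remaining pieces are
  prefixes of forest words, hence of height at least 0, and together with the inner 0 they would
  have positive total height.\<close>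

lemma cycle_lemma_unique:
  assumes "cyc (False # fw ts) (False # fw us)" shows "ts = us"
proof -
  obtain x y where e: "False # fw us = x @ y" "False # fw ts = y @ x"
    using assms unfolding cyc_def by blast
  show ?thesis
  proof (cases "x = [] \<or> y = []")
    case True
    then show ?thesis using e by (auto intro: fw_inj)
  next
    case False
    then obtain x' y' where xy: "x = False # x'" "y = False # y'"
      using e by (auto simp: Cons_eq_append_conv)
    have 1: "fw us = x' @ False # y'" "fw ts = y' @ False # x'"
      using e xy by auto
    have "hgt x' \<ge> 0" "hgt y' \<ge> 0" using fw_prefix_nonneg 1 by blast+
    moreover have "hgt (x' @ False # y') = 0" using 1 by (metis hgt_fw)
    ultimately show ?thesis by simp
  qed
qed

text \<open>Delete a cyclically adjacent 01, rotate the shorter word by induction, and put the 01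
  back as a new leaf via \<open>fw_insert_peak\<close>.\<close>

lemma cycle_lemma_exists:
  "hgt x = 1 \<Longrightarrow> \<exists>ts. cyc x (False # fw ts)"
proof (induction "length x" arbitrary: x rule: less_induct)
  case less
  have "False \<in> set x"
  proof (rule ccontr)
    assume "False \<notin> set x"
    then have "x = replicate (length x) True"
      by (metis (full_types) replicate_length_same)
    then have "hgt x = - int (length x)" by (metis hgt_replicate)
    then show False using less.prems by simp
  qed
  then obtain A B where x: "x = A @ False # B" by (meson split_list)
  define y where "y = B @ A"
  have xy: "cyc x (False # y)" using cyc_swap[of A "False # B"] x y_def by simp
  show ?case
  proof (cases "True \<in> set y")
    case False
    then have "y = replicate (length y) False"
      by (metis (full_types) replicate_length_same)
    then have "hgt y = int (length y)" by (metis hgt_replicate)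
    then have "y = []" using cyc_hgt[OF xy] less.prems by simp
    then show ?thesis using xy by (auto intro: exI[of _ "[]"])
  next
    case True
    then obtain C E where y: "y = C @ True # E" "True \<notin> set C" by (meson split_list_first)
    then have C: "C = replicate (length C) False"
      by (metis (full_types) replicate_length_same)
    \<comment> \<open>The leading 0 slides through the run \<open>C\<close> of 0s, so that it stands
      directly before the first 1 and forms the peak to delete.\<close>
    then have "False # y = C @ False # True # E"
      using y by (metis append_Cons replicate_app_Cons_same)
    then have x1: "cyc x (False # True # E @ C)"
      using cyc_trans[OF xy] cyc_swap[of C "False # True # E"] by simp
    have "hgt (E @ C) = 1" using cyc_hgt[OF x1] less.prems by simp
    moreover have "length (E @ C) < length x" using cyc_length[OF x1] by simp
    ultimately obtain ts where "cyc (E @ C) (False # fw ts)" using less.hyps by blast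
    then obtain P Q where PQ: "E @ C = P @ Q" "False # fw ts = Q @ P"
      unfolding cyc_def by metis
    have x2: "cyc x (Q @ False # True # P)"
      using cyc_trans[OF x1] PQ(1) cyc_swap[of "False # True # P" Q] by simp
    show ?thesis
    proof (cases Q)
      \<comment> \<open>The peak sat at the seam of the rotated word; it becomes a last tree of the
        forest.\<close>
      case Nil
      then have "cyc x (P @ [False, True])"
        using cyc_trans[OF x2] cyc_swap[of "[False, True]" P] by simp
      moreover have "P @ [False, True] = False # fw (ts @ [Node []])" using PQ Nil by simp
      ultimately show ?thesis by metis
    next
      case (Cons b Q')
      then have "\<not> b" "fw ts = Q' @ P" using PQ by auto
      then obtain us where "fw us = Q' @ False # True # P" using fw_insert_peak by blast
      then show ?thesis using x2 Cons \<open>\<not> b\<close> by (metis (full_types) append_Cons)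
    qed
  qed
qed

section \<open>Germs as construction sequences of forests\<close>

text \<open>\<open>r\<close> bounds the next entry. It will always be the number of trees present,
  so that admissibility means that each entry can be executed by \<open>grow\<close>.\<close>

fun adm :: "nat \<Rightarrow> nat list \<Rightarrow> bool" where
  "adm r [] = True"
| "adm r (a # \<alpha>) = (a \<le> r \<and> adm (a + 1) \<alpha>)"

text \<open>An entry \<open>a\<close> keeps the last \<open>a\<close> trees and puts all earlier
  ones under a new root at the end. There are then \<open>a + 1\<close> trees, which is exactly the
  germ bound for the next entry.\<close>

definition grow :: "tree list \<Rightarrow> nat \<Rightarrow> tree list" where
  "grow cs a = drop (length cs - a) cs @ [Node (take (length cs - a) cs)]"

lemma length_grow: "a \<le> length cs \<Longrightarrow> length (grow cs a) = a + 1"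
  by (simp add: grow_def)

lemma adm_append:
  "adm (length cs) (\<alpha> @ \<beta>) \<longleftrightarrow> adm (length cs) \<alpha> \<and> adm (length (foldl grow cs \<alpha>)) \<beta>"
proof (induction \<alpha> arbitrary: cs)
  case (Cons a \<alpha>)
  show ?case
  proof (cases "a \<le> length cs")
    case True
    then show ?thesis using Cons[of "grow cs a"] by (simp add: length_grow)
  qed simp
qed simp

lemma length_fw_grow: "length (fw (grow cs a)) = length (fw cs) + 2"
proof -
  have "length (fw cs) = length (fw (take (length cs - a) cs)) + length (fw (drop (length cs - a) cs))"
    by (metis append_take_drop_id fw_append length_append)
  then show ?thesis by (simp add: grow_def)
qed

lemma length_fw_foldl_grow: "length (fw (foldl grow cs \<alpha>)) = length (fw cs) + 2 * length \<alpha>"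
  by (induction \<alpha> arbitrary: cs) (auto simp: length_fw_grow)

lemma grow_inj:
  assumes "grow cs a = grow ds b" "a \<le> length cs" "b \<le> length ds"
  shows "a = b \<and> cs = ds"
proof -
  have ab: "a = b" using assms length_grow by (metis add_right_cancel)
  have "drop (length cs - a) cs = drop (length ds - b) ds"
    "take (length cs - a) cs = take (length ds - b) ds"
    using assms(1) unfolding grow_def by auto
  then show ?thesis using ab by (metis append_take_drop_id)
qed

lemma foldl_grow_inj:
  assumes "foldl grow cs \<alpha> = foldl grow ds \<beta>" "length \<alpha> = length \<beta>"
    "adm (length cs) \<alpha>" "adm (length ds) \<beta>"
  shows "cs = ds \<and> \<alpha> = \<beta>"
  using assms
proof (induction \<alpha> arbitrary: cs ds \<beta>)
  case (Cons a \<alpha>)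
  obtain b \<beta>' where \<beta>: "\<beta> = b # \<beta>'" using Cons.prems(2) by (cases \<beta>) auto
  have ab: "a \<le> length cs" "b \<le> length ds" using Cons.prems \<beta> by auto
  have "grow cs a = grow ds b \<and> \<alpha> = \<beta>'"
    using Cons.IH[of "grow cs a" "grow ds b" \<beta>'] Cons.prems \<beta> length_grow ab by simp
  then show ?case using grow_inj ab \<beta> by blast
qed simp

text \<open>A step is undone by replacing the last tree with its children, moved to the front; the
  number of the other trees is the last entry.\<close>

lemma foldl_grow_surj:
  "\<exists>\<alpha>. adm 0 \<alpha> \<and> foldl grow [] \<alpha> = ts"
proof (induction "length (fw ts)" arbitrary: ts rule: less_induct)
  case less
  show ?case
  proof (cases ts rule: rev_cases)
    case Nil
    then show ?thesis by (auto intro: exI[of _ "[]"])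
  next
    case (snoc ds t)
    obtain us where t: "t = Node us" by (cases t)
    define ps where "ps = us @ ds"
    have ts: "ts = grow ps (length ds)" by (simp add: grow_def ps_def snoc t)
    then have "length (fw ps) < length (fw ts)" by (simp add: length_fw_grow)
    then obtain \<alpha> where \<alpha>: "adm 0 \<alpha>" "foldl grow [] \<alpha> = ps" using less.hyps by blast
    then have "adm 0 (\<alpha> @ [length ds])"
      using adm_append[of "[]" \<alpha> "[length ds]"] by (simp add: ps_def)
    then show ?thesis using \<alpha> ts by (metis foldl_Cons foldl_Nil foldl_append)
  qed
qed

lemma is_germ_iff: "is_germ k \<alpha> \<longleftrightarrow> k > 1 \<and> length \<alpha> = k - 1 \<and> adm 1 \<alpha>"
proof -
  have adm_iff: "adm r \<alpha> \<longleftrightarrow> (\<alpha> \<noteq> [] \<longrightarrow> \<alpha> ! 0 \<le> r) \<and> (\<forall>i. Suc i < length \<alpha> \<longrightarrow> \<alpha> ! Suc i \<le> \<alpha> ! i + 1)"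
    for r
  proof (induction \<alpha> arbitrary: r)
    case (Cons a \<alpha>)
    show ?case
      using Cons[of "a + 1"]
      by (auto simp: nth_Cons less_Suc_eq_0_disj split: nat.splits)
  qed simp
  have e: "(\<forall>i. 1 < i \<and> i < k \<longrightarrow> entry \<alpha> (i - 1) \<le> entry \<alpha> i + 1) \<longleftrightarrow>
      (\<forall>i. Suc i < length \<alpha> \<longrightarrow> \<alpha> ! Suc i \<le> \<alpha> ! i + 1)" (is "?L \<longleftrightarrow> ?R")
    if "length \<alpha> = k - 1" "k > 1"
  proof
    assume L: ?L
    show ?R
    proof (intro allI impI)
      fix i assume "Suc i < length \<alpha>"
      then show "\<alpha> ! Suc i \<le> \<alpha> ! i + 1"
        using spec[OF L, of "length \<alpha> - i"] that unfolding entry_def by (auto simp: Suc_diff_Suc)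
    qed
  next
    assume R: ?R
    show ?L
    proof (intro allI impI)
      fix i assume i: "1 < i \<and> i < k"
      then have "length \<alpha> - (i - 1) = Suc (length \<alpha> - i)" using that by auto
      then show "entry \<alpha> (i - 1) \<le> entry \<alpha> i + 1"
        using spec[OF R, of "length \<alpha> - i"] that i unfolding entry_def by auto
    qed
  qed
  show ?thesis
    unfolding is_germ_def adm_iff[of 1]
    using e by (cases \<alpha>) (auto simp: entry_def)
qed

section \<open>The labels of \<open>F\<close>\<close>

abbreviation bits :: "nat option list \<Rightarrow> bool list" where
  "bits \<equiv> map (\<lambda>x. x = None)"

text \<open>\<open>lab G c\<close>: in the cyclic string \<open>G c\<close>, every number in \<open>G\<close> counts the 0-steps below level 0
  of the path that starts just after it and goes once around.\<close>

fun lab :: "nat option list \<Rightarrow> bool list \<Rightarrow> bool" where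
  "lab [] c = True"
| "lab (x # G) c = ((\<forall>p. x = Some p \<longrightarrow> p = flaw 0 (bits G @ c)) \<and> lab G (c @ [x = None]))"

lemma lab_append: "lab (G @ H) c \<longleftrightarrow> lab G (bits H @ c) \<and> lab H (c @ bits G)"
  by (induction G arbitrary: c) auto

lemma lab_replicate_None: "lab (replicate n None) c"
  by (induction n arbitrary: c) auto

text \<open>A label in \<open>G\<close> followed by \<open>B\<close> enters \<open>c\<close> at
  height \<open>hgt B\<close>, so only the statistic of \<open>c\<close> from such heights matters,
  and \<open>hgt c\<close> for what is read afterwards.\<close>

lemma lab_cong:
  assumes "\<And>A B. bits G = A @ False # B \<Longrightarrow> flaw (hgt B) c = flaw (hgt B) c'" "hgt c = hgt c'"
  shows "lab G c = lab G c'"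
  using assms
proof (induction G arbitrary: c c')
  case (Cons x G)
  have "lab G (c @ [x = None]) = lab G (c' @ [x = None])"
  proof (rule Cons.IH)
    fix A B assume "bits G = A @ False # B"
    then have "bits (x # G) = ((x = None) # A) @ False # B" by simp
    then show "flaw (hgt B) (c @ [x = None]) = flaw (hgt B) (c' @ [x = None])"
      using Cons.prems(1)[of "(x = None) # A" B] Cons.prems(2) by (simp only: flaw_append)
  qed (use Cons.prems in simp)
  moreover have "flaw 0 (bits G @ c) = flaw 0 (bits G @ c')" if "x = Some p" for p
    using Cons.prems(1)[of "[]" "bits G"] that by simp
  ultimately show ?case by auto
qed simp

text \<open>This is the null germ. After label \<open>j\<close> the path climbs
  \<open>m - j - 1\<close> steps and descends \<open>l\<close>, reaching level \<open>-j\<close> or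
  lower; the final \<open>j\<close> up steps are then exactly those below level 0.\<close>

lemma lab_map_Some_upt:
  assumes "m \<le> l + 1" "j \<le> m"
  shows "lab (map Some [j..<m]) (replicate l True @ replicate j False)"
  using assms(2)
proof (induction j rule: inc_induct)
  case (step j)
  have b: "bits (map Some [Suc j..<m]) = replicate (m - Suc j) False"
    by (simp add: o_def map_replicate_const)
  have "flaw 0 (replicate (m - Suc j) False @ replicate l True @ replicate j False) = j"
    using step.hyps assms(1) by (simp add: flaw_replicate_False_nonneg flaw_replicate_False_neg)
  moreover have "replicate j False @ [False] = replicate (Suc j) False"
    by (simp add: replicate_append_same)
  ultimately show ?case
    using step by (simp add: upt_conv_Cons b del: upt_Suc map_map flaw_append)
qed simp

text \<open>Labels in \<open>W\<close> see \<open>X\<close> and \<open>Y\<close> at nonnegative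
  height, where neither counts. Labels in \<open>X\<close> or \<open>Y\<close> traverse
  \<open>Z\<close> and then \<open>W\<close> from a height at most 0 whether or not the other block
  comes before; this descent and ascent always counts \<open>i\<close> and returns to the same
  level, so it commutes with that block. \<open>Z\<close> carries no labels.\<close>

lemma lab_swap:
  assumes lab: "lab (W @ X @ Y @ Z) []"
    and W: "bits W = replicate i False" and Z: "bits Z = replicate i True"
    and X: "bits X = fw as @ False # fw bs" and Y: "bits Y = fw us"
  shows "lab (W @ Y @ X @ Z) []"
proof -
  have hX: "hgt (bits X) = 1" and hY: "hgt (bits Y) = 0" by (simp_all add: X Y)
  have fX: "flaw h (bits X) = 0" and fY: "flaw h (bits Y) = 0" if "h \<ge> 0" for h
    using that by (simp_all add: X Y flaw_fw_nonneg)
  have fZW: "flaw h (bits Z @ bits W) = i" if "h \<le> 0" for h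
    using that by (simp add: W Z flaw_replicate_False_neg)
  have "lab W (bits X @ bits Y @ bits Z) = lab W (bits Y @ bits X @ bits Z)"
  proof (rule lab_cong)
    fix A B assume "bits W = A @ False # B"
    then have "set (A @ False # B) \<subseteq> {False}" unfolding W by (metis in_set_replicate singleton_iff subsetI)
    then have "B = replicate (length B) False" by (intro replicate_length_same[symmetric]) auto
    then have "hgt B \<ge> 0" by (metis hgt_replicate of_nat_0_le_iff)
    then show "flaw (hgt B) (bits X @ bits Y @ bits Z) = flaw (hgt B) (bits Y @ bits X @ bits Z)"
      by (simp add: fX fY hX hY)
  qed simp
  moreover have "lab X (bits Y @ bits Z @ bits W) = lab X (bits Z @ bits W @ bits Y)"
  proof (rule lab_cong)
    fix A B assume e: "bits X = A @ False # B"
    \<comment> \<open>\<open>X\<close> lacks only a closing 1 to be a forest word; once completed,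
      its prefixes have nonnegative height.\<close>
    then have "fw (as @ [Node bs]) = A @ False # B @ [True]" by (simp add: X)
    then have "hgt A \<ge> 0" by (rule fw_prefix_nonneg)
    moreover have "hgt (A @ False # B) = 1" using e hX by simp
    ultimately have "hgt B \<le> 0" by simp
    then show "flaw (hgt B) (bits Y @ bits Z @ bits W) = flaw (hgt B) (bits Z @ bits W @ bits Y)"
      using fZW[of "hgt B"] by (simp add: hY W Z)
  qed simp
  moreover have "lab Y (bits Z @ bits W @ bits X) = lab Y (bits X @ bits Z @ bits W)"
  proof (rule lab_cong)
    fix A B assume e: "bits Y = A @ False # B"
    then have "hgt A \<ge> 0" using fw_prefix_nonneg Y by metis
    moreover have "hgt (A @ False # B) = 0" using e hY by simp
    ultimately have "hgt B \<le> - 1" by simp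
    then show "flaw (hgt B) (bits Z @ bits W @ bits X) = flaw (hgt B) (bits X @ bits Z @ bits W)"
      using fZW[of "hgt B"] fZW[of "hgt B + 1"] by (simp add: hX W Z)
  qed simp
  moreover have "lab Z c" for c
  proof -
    have "Z = replicate (length Z) None"
    proof (rule nth_equalityI)
      fix n assume n: "n < length Z"
      then have "bits Z ! n" using Z by (metis length_map length_replicate nth_replicate)
      then show "Z ! n = replicate (length Z) None ! n" using n by simp
    qed simp
    then show ?thesis by (metis lab_replicate_None)
  qed
  ultimately show ?thesis
    using lab by (simp add: lab_append)
qed

text \<open>Each entry 0 puts the whole forest under one root. The trailing zeros of a germ thus
  produce the initial 0s and final 1s that \<open>F\<close> leaves in place as \<open>W\<close> and
  \<open>Z\<close>.\<close>

lemma fw_nest: "fw (foldl grow cs (replicate j 0)) = replicate j False @ fw cs @ replicate j True"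
proof (induction j arbitrary: cs)
  case (Suc j)
  show ?case using Suc[of "grow cs 0"]
    by (simp add: grow_def replicate_app_Cons_same)
qed simp

lemma rightmost_nonzero_eq:
  assumes "a \<noteq> 0"
  shows "rightmost_nonzero (\<beta> @ a # replicate j 0) = Suc j"
  unfolding rightmost_nonzero_def
proof (rule Least_equality)
  show "1 \<le> Suc j \<and> Suc j \<le> length (\<beta> @ a # replicate j 0) \<and> entry (\<beta> @ a # replicate j 0) (Suc j) \<noteq> 0"
    using assms by (simp add: entry_def)
next
  fix i assume i: "1 \<le> i \<and> i \<le> length (\<beta> @ a # replicate j 0) \<and> entry (\<beta> @ a # replicate j 0) i \<noteq> 0"
  show "Suc j \<le> i"
  proof (rule ccontr)
    assume "\<not> Suc j \<le> i"
    then have "length (\<beta> @ a # replicate j 0) - i = length \<beta> + Suc (j - i)" using i by simp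
    moreover have "(\<beta> @ a # replicate j 0) ! (length \<beta> + Suc (j - i)) = 0"
      using i \<open>\<not> Suc j \<le> i\<close> by (subst nth_append_length_plus) simp
    ultimately have "entry (\<beta> @ a # replicate j 0) i = 0"
      by (simp only: entry_def)
    then show False using i by simp
  qed
qed

lemma parent_eq:
  assumes "a \<noteq> 0"
  shows "parent (\<beta> @ a # replicate j 0) = \<beta> @ (a - 1) # replicate j 0"
proof -
  have l: "length (\<beta> @ a # replicate j 0) - Suc j = length \<beta>" by simp
  show ?thesis
    unfolding parent_def Let_def rightmost_nonzero_eq[OF assms] entry_def l
    by (simp only: list_update_length nth_append_length)
qed

lemma not_replicate_0_decomp:
  assumes "\<alpha> \<noteq> replicate (length \<alpha>) (0::nat)"
  obtains \<beta> a j where "\<alpha> = \<beta> @ a # replicate j 0" "a \<noteq> 0"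
proof -
  have "\<exists>x \<in> set \<alpha>. x \<noteq> 0"
    using assms by (metis replicate_length_same)
  then obtain \<beta> a \<gamma> where \<alpha>: "\<alpha> = \<beta> @ a # \<gamma>" "a \<noteq> 0" "\<forall>x\<in>set \<gamma>. \<not> x \<noteq> 0"
    using split_list_last_prop[of \<alpha> "\<lambda>x. x \<noteq> 0"] by blast
  then have "\<gamma> = replicate (length \<gamma>) 0" by (metis replicate_length_same)
  then show ?thesis using that \<alpha> by metis
qed

lemma F_step:
  assumes G: "F (\<beta> @ (a - 1) # replicate j 0) = W @ X @ Y @ Z"
    and "a \<noteq> 0" "length W = Suc j" "length Z = Suc j"
    and X: "X = Some \<Omega> # X'" and Y: "Y = Some (\<Omega> + 1) # Y'"
    and nin: "Some (\<Omega> + 1) \<notin> set X"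
  shows "F (\<beta> @ a # replicate j 0) = W @ Y @ X @ Z"
proof -
  let ?\<alpha> = "\<beta> @ a # replicate j 0"
  have nz: "?\<alpha> \<noteq> replicate (length ?\<alpha>) 0"
    using assms(2) by (metis in_set_conv_decomp in_set_replicate)
  have tw: "takeWhile (\<lambda>x. x \<noteq> Some (\<Omega> + 1)) (X @ Y) = X"
    "dropWhile (\<lambda>x. x \<noteq> Some (\<Omega> + 1)) (X @ Y) = Y"
    using nin Y by (auto simp: takeWhile_append dropWhile_append)
  have l: "length (W @ X @ Y @ Z) - Suc j = length (W @ X @ Y)"
    "length (W @ X @ Y @ Z) - 2 * Suc j = length (X @ Y)"
    using assms by auto
  have 1: "take (Suc j) (W @ X @ Y @ Z) = W"
    "drop (length (W @ X @ Y)) (W @ X @ Y @ Z) = Z"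
    "take (length (X @ Y)) (drop (Suc j) (W @ X @ Y @ Z)) = X @ Y"
    using assms(3) by (simp_all flip: append_assoc) 
  have "the (hd (X @ Y)) = \<Omega>" by (simp add: X)
  then show ?thesis
    using nz by (simp only: F.simps[of ?\<alpha>] Let_def rightmost_nonzero_eq[OF assms(2)]
      parent_eq[OF assms(2)] G l 1 if_False tw simp_thms)
qed

lemma map_eq_appendE:
  assumes "map f G = u @ v"
  obtains A B where "G = A @ B" "map f A = u" "map f B = v"
  using assms by (auto simp: map_eq_append_conv)

lemma count_labels:
  "count (mset (map Some [0..<m] @ replicate n None)) (Some p) = (if p < m then 1 else 0)"
proof -
  have "distinct (map Some [0..<m])" by (simp add: distinct_map)
  then have "count (mset (map Some [0..<m])) (Some p) = (if p < m then 1 else 0)"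
    unfolding distinct_count_atmost_1 by auto
  then show ?thesis by simp
qed

text \<open>The induction follows the recursion of \<open>F\<close> through \<open>parent\<close>,
  which lowers the entry sum. Bits, labels and multiset are proved together because the cut made by
  \<open>F\<close> depends on the labels, and the labels depend on the bits.\<close>

lemma F_structure:
  assumes "adm 1 \<alpha>"
  shows "bits (F \<alpha>) = False # fw (foldl grow [Node []] \<alpha>) \<and> lab (F \<alpha>) [] \<and>
    mset (F \<alpha>) = mset (map Some [0..<length \<alpha> + 2] @ replicate (length \<alpha> + 1) None)"
  using assms
proof (induction "sum_list \<alpha>" arbitrary: \<alpha> rule: less_induct)
  case less
  show ?case
  proof (cases "\<alpha> = replicate (length \<alpha>) 0")
    case True
    define n where "n = length \<alpha>"
    have F: "F \<alpha> = map Some [0..<n + 2] @ replicate (n + 1) None"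
      using True by (simp add: F.simps[of \<alpha>] Let_def n_def del: upt_Suc)
    have "fw (foldl grow [Node []] \<alpha>) = replicate n False @ [False, True] @ replicate n True"
      using fw_nest[of "[Node []]" n] True n_def by simp
    moreover have "bits (F \<alpha>) = replicate (n + 2) False @ replicate (n + 1) True"
      by (simp only: F map_append map_map) (simp add: o_def map_replicate_const del: upt_Suc)
    ultimately have 1: "bits (F \<alpha>) = False # fw (foldl grow [Node []] \<alpha>)"
      by (simp add: replicate_app_Cons_same)
    have "lab (map Some [0..<n + 2]) (replicate (n + 1) True)"
      using lab_map_Some_upt[of "n + 2" "n + 1" 0] by (simp del: upt_Suc)
    then have "lab (F \<alpha>) []"
      unfolding F lab_append by (simp add: lab_replicate_None del: upt_Suc replicate_Suc)
    then show ?thesis using 1 F by (simp add: n_def)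
  next
    case False
    then obtain \<beta> a j where \<alpha>: "\<alpha> = \<beta> @ a # replicate j 0" and a: "a \<noteq> 0"
      by (rule not_replicate_0_decomp)
    define cs where "cs = foldl grow [Node []] \<beta>"
    define r where "r = length cs"
    define \<alpha>' where "\<alpha>' = \<beta> @ (a - 1) # replicate j 0"
    have adm: "adm 1 \<beta>" "a \<le> r" "adm (a + 1) (replicate j 0)"
      using less.prems adm_append[of "[Node []]" \<beta> "a # replicate j 0"] by (auto simp: \<alpha> r_def cs_def)
    have adm0: "adm m (replicate j 0)" for m by (induction j arbitrary: m) auto
    have "adm 1 \<alpha>'"
      using adm adm0 adm_append[of "[Node []]" \<beta> "(a - 1) # replicate j 0"] 
      by (simp add: \<alpha>'_def r_def cs_def)
    moreover have "sum_list \<alpha>' < sum_list \<alpha>" using a by (simp add: \<alpha>'_def \<alpha>)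
    ultimately have IH: "bits (F \<alpha>') = False # fw (foldl grow [Node []] \<alpha>')" "lab (F \<alpha>') []"
      "mset (F \<alpha>') = mset (map Some [0..<length \<alpha>' + 2] @ replicate (length \<alpha>' + 1) None)"
      using less.hyps by blast+
    define as where "as = drop (Suc (r - a)) cs"
    define bs where "bs = take (r - a) cs"
    obtain us where us: "cs ! (r - a) = Node us" by (cases "cs ! (r - a)")
    have ra: "r - a < length cs" using a adm(2) by (simp add: r_def)
    have cs1: "drop (r - a) cs = Node us # as" "take (Suc (r - a)) cs = bs @ [Node us]"
      using ra us by (auto simp: as_def bs_def Cons_nth_drop_Suc[symmetric] take_Suc_conv_app_nth)
    have "r - (a - 1) = Suc (r - a)" using a adm(2) by simp
    \<comment> \<open>The tree \<open>Node us\<close> moves from last child of the last tree to the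
      front of the queue. In the word this exchanges \<open>X\<close>, which is \<open>as\<close>
      followed by the open root and \<open>bs\<close>, with \<open>Y\<close>, the word of
      \<open>Node us\<close>.\<close>
    then have gr: "grow cs (a - 1) = as @ [Node (bs @ [Node us])]" "grow cs a = Node us # as @ [Node bs]"
      using cs1 by (auto simp: grow_def as_def bs_def r_def)
    have split: "bits (F \<alpha>') = replicate (Suc j) False @ (fw as @ False # fw bs) @ fw [Node us] @ replicate (Suc j) True"
      unfolding IH(1) by (simp add: \<alpha>'_def cs_def[symmetric] fw_nest gr del: One_nat_def)
    obtain W R1 where 1: "F \<alpha>' = W @ R1" "bits W = replicate (Suc j) False"
      "bits R1 = (fw as @ False # fw bs) @ fw [Node us] @ replicate (Suc j) True"
      by (rule map_eq_appendE[OF split])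
    obtain X R2 where 2: "R1 = X @ R2" "bits X = fw as @ False # fw bs"
      "bits R2 = fw [Node us] @ replicate (Suc j) True"
      by (rule map_eq_appendE[OF 1(3)])
    obtain Y Z where 3: "R2 = Y @ Z" "bits Y = fw [Node us]" "bits Z = replicate (Suc j) True"
      by (rule map_eq_appendE[OF 2(3)])
    have G: "F \<alpha>' = W @ X @ Y @ Z"
      and W: "bits W = replicate (Suc j) False" and X: "bits X = fw as @ False # fw bs"
      and Y: "bits Y = fw [Node us]" and Z: "bits Z = replicate (Suc j) True"
      by (simp only: 1(1) 2(1) 3(1), rule 1(2), rule 2(2), rule 3(2), rule 3(3))
    have lenW: "length W = Suc j" and lenZ: "length Z = Suc j"
      using arg_cong[OF W, of length] arg_cong[OF Z, of length] by simp_all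
    have labX: "lab X (bits Y @ bits Z @ bits W)" and labY: "lab Y (bits Z @ bits W @ bits X)"
      using IH(2) by (simp_all only: G lab_append map_append append_assoc append_Nil append_Nil2)
    have las: "length as = a - 1" using a adm(2) by (simp add: as_def r_def)
    \<comment> \<open>From the first step of \<open>X\<close>, the \<open>a - 1\<close> trees of
      \<open>as\<close> and the \<open>j + 1\<close> 0s of \<open>W\<close> give
      \<open>a + j\<close>: if \<open>as\<close> is nonempty, its first root is replaced in the
      count by the open root. From the first step of \<open>Y\<close>, that first root counts too,
      giving \<open>a + j + 1\<close>.\<close>
    define \<Omega> where "\<Omega> = a + j"
    have fr: "flaw h (replicate j False) = j" if "h + int j \<le> 0" for h
      using that by (rule flaw_replicate_False_neg)
    have "\<exists>X'. X = Some \<Omega> # X'"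
    proof -
      obtain x X' where x: "X = x # X'" using X by (cases X) auto
      have xn: "x \<noteq> None" using X x by (cases as rule: fw.cases) auto
      have "flaw 0 (bits X' @ bits Y @ bits Z @ bits W) = \<Omega>"
      proof (cases as rule: fw.cases)
        case 1
        then have "a = 1" using las a by simp
        moreover have "bits X' = fw bs" using X x 1 by simp
        ultimately show ?thesis
          by (simp add: Y Z W flaw_fw_nonneg fr \<Omega>_def)
      next
        case (2 vs ts)
        then have "bits X' = fw vs @ True # fw ts @ False # fw bs" using X x by simp
        moreover have "length ts = a - 2" "a \<ge> 2" using 2 las by auto
        ultimately show ?thesis
          by (simp add: Y Z W flaw_fw_nonneg flaw_fw_minus_one fr \<Omega>_def)
      qed
      then show ?thesis using labX x xn by auto
    qed
    then obtain X' where X': "X = Some \<Omega> # X'" by blast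
    have "\<exists>Y'. Y = Some (\<Omega> + 1) # Y'"
    proof -
      obtain y Y' where y: "Y = y # Y'" using Y by (cases Y) auto
      have yn: "y \<noteq> None" "bits Y' = fw us @ [True]" using Y y by auto
      have "flaw 0 (bits Y' @ bits Z @ bits W @ bits X) = \<Omega> + 1"
        using a by (simp add: yn X Z W flaw_fw_nonneg flaw_fw_minus_one las fr \<Omega>_def)
      then show ?thesis using labY y yn by auto
    qed
    then obtain Y' where Y': "Y = Some (\<Omega> + 1) # Y'" by blast
    have cnt: "count (mset (F \<alpha>')) (Some (\<Omega> + 1)) \<le> 1"
      unfolding IH(3) count_labels by simp
    \<comment> \<open>Each number occurs once and this one heads \<open>Y\<close>, so the scan for
      it stops exactly at the border of \<open>X\<close> and \<open>Y\<close>.\<close>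
    have "Some (\<Omega> + 1) \<notin> set X"
    proof
      assume "Some (\<Omega> + 1) \<in> set X"
      then have "count (mset X) (Some (\<Omega> + 1)) \<ge> 1" by (simp add: Suc_le_eq)
      then show False using cnt unfolding G Y' by simp
    qed
    then have F: "F \<alpha> = W @ Y @ X @ Z"
      unfolding \<alpha> by (rule F_step[OF G[unfolded \<alpha>'_def] a lenW lenZ X' Y'])
    have "bits (F \<alpha>) = False # fw (foldl grow [Node []] \<alpha>)"
      unfolding F by (simp add: W X Y Z \<alpha> cs_def[symmetric] fw_nest gr)
    moreover have "lab (F \<alpha>) []"
      using lab_swap[OF _ W Z X Y] IH(2) unfolding F G by blast
    moreover have "mset (F \<alpha>) = mset (map Some [0..<length \<alpha> + 2] @ replicate (length \<alpha> + 1) None)"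
    proof -
      have "mset (F \<alpha>) = mset (F \<alpha>')" by (simp add: F G)
      moreover have "length \<alpha> = length \<alpha>'" by (simp add: \<alpha> \<alpha>'_def)
      ultimately show ?thesis using IH(3) by simp
    qed
    ultimately show ?thesis by blast
  qed
qed

lemma \<theta>_eq: "adm 1 \<alpha> \<Longrightarrow> \<theta> \<alpha> = False # fw (foldl grow [] (0 # \<alpha>))"
  using F_structure[of \<alpha>] by (simp add: \<theta>_def grow_def)

lemma count_F:
  assumes "adm 1 \<alpha>"
  shows "count (mset (F \<alpha>)) (Some p) = (if p < length \<alpha> + 2 then 1 else 0)"
  using F_structure[OF assms] by (simp only: count_labels)

lemma label_eq_flaw:
  assumes "adm 1 \<alpha>" "F \<alpha> = A @ Some p # B"
  shows "flaw 0 (bits B @ bits A) = p"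
proof -
  have "lab (A @ Some p # B) []" using F_structure[OF assms(1)] unfolding assms(2) by blast
  then show ?thesis by (simp add: lab_append)
qed

lemma F_occurrence_unique:
  assumes "adm 1 \<alpha>" "F \<alpha> = A @ Some p # B" "F \<alpha> = A' @ Some p # B'"
  shows "A = A' \<and> B = B'"
proof -
  have c: "count (mset (F \<alpha>)) (Some p) \<le> 1" using count_F[OF assms(1)] by simp
  have nA: "Some p \<notin> set A" "Some p \<notin> set B" using c assms(2) by (auto simp: count_eq_zero_iff)
  then show ?thesis using assms append_Cons_eq_iff[of "Some p" A B A' B'] by simp
qed

lemma rotation_at_label:
  assumes "adm 1 \<alpha>" "cyc (False # w) (\<theta> \<alpha>)"
  obtains A B where "F \<alpha> = A @ Some (flaw 0 w) # B" "bits B @ bits A = w"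
proof -
  obtain x y where xy: "\<theta> \<alpha> = x @ y" "False # w = y @ x" using assms(2) unfolding cyc_def by blast
  obtain x' y' where e: "\<theta> \<alpha> = x' @ False # y'" "w = y' @ x'"
  proof (cases y)
    case Nil
    then show ?thesis using that[of "[]" w] xy by simp
  next
    case (Cons b y')
    then show ?thesis using that[of x y'] xy by simp
  qed
  then have "bits (F \<alpha>) = x' @ False # y'" by (simp add: \<theta>_def)
  then obtain A R where AR: "F \<alpha> = A @ R" "bits A = x'" "bits R = False # y'"
    by (rule map_eq_appendE)
  then obtain z B where zB: "R = z # B" "z \<noteq> None" "bits B = y'" by auto
  then obtain p where p: "z = Some p" by auto
  have "F \<alpha> = A @ Some p # B" using AR zB p by simp
  moreover have "p = flaw 0 w"
    using label_eq_flaw[OF assms(1) calculation] AR(2) zB(3) e(2) by simp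
  moreover have "bits B @ bits A = w" using AR(2) zB(3) e(2) by simp
  ultimately show ?thesis using that by blast
qed

text \<open>Every rotation starting with a 0 starts at a number of \<open>F\<close>, and this number
  is the statistic of the rest. Distinct numbers then force distinct statistics.\<close>

lemma rotation_unique:
  assumes "adm 1 \<alpha>" "cyc (False # w) (\<theta> \<alpha>)" "cyc (False # w') (\<theta> \<alpha>)" "flaw 0 w = flaw 0 w'"
  shows "w = w'"
proof -
  obtain A B where 1: "F \<alpha> = A @ Some (flaw 0 w) # B" "bits B @ bits A = w"
    using rotation_at_label[OF assms(1,2)] .
  obtain A' B' where 2: "F \<alpha> = A' @ Some (flaw 0 w') # B'" "bits B' @ bits A' = w'"
    using rotation_at_label[OF assms(1,3)] .
  have "A = A' \<and> B = B'"
    using F_occurrence_unique[OF assms(1) 1(1)] 2(1) assms(4) by simp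
  then show ?thesis using 1 2 by simp
qed

section \<open>The path seen from a label\<close>

text \<open>\<open>interleave (gaps r \<rho>) cs\<close> is the cyclic word of \<open>foldl grow cs \<rho>\<close> read from just after its
  \<open>length \<rho>\<close>-th label: the trees of \<open>cs\<close> are its positive excursions, and what
  lies between them is weakly below level 0 and depends only on \<open>\<rho>\<close> and \<open>r = length cs\<close>.\<close>

fun gaps :: "nat \<Rightarrow> nat list \<Rightarrow> bool list list" where
  "gaps r [] = replicate (r + 1) []"
| "gaps r (a # \<rho>) = (let M = gaps (a + 1) \<rho> in
     replicate (r - a) [] @ (True # last M @ False # hd M) # butlast (tl M))"

fun interleave :: "bool list list \<Rightarrow> tree list \<Rightarrow> bool list" where
  "interleave [] ts = []"
| "interleave (n # ns) [] = n"
| "interleave (n # ns) (t # ts) = n @ fw [t] @ interleave ns ts"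

text \<open>The excursions weakly below level 0: balanced, with every up step starting at negative
  height. Stating this by counts avoids prefix heights and is additive.\<close>

definition low :: "bool list \<Rightarrow> bool" where
  "low n \<longleftrightarrow> hgt n = 0 \<and> flaw 0 n = ups n"

lemma low_flaw_neg: "low n \<Longrightarrow> h \<le> 0 \<Longrightarrow> flaw h n = ups n"
  using flaw_antimono[of h 0 n] flaw_le_ups[of h n] by (simp add: low_def)

lemma low_Nil [simp]: "low []"
  by (simp add: low_def)

lemma split_first_last:
  assumes "length M = a + 2"
  obtains m0 ms ml where "M = m0 # ms @ [ml]" "length ms = a"
proof -
  obtain m0 M' where 1: "M = m0 # M'" using assms by (cases M) auto
  obtain ms ml where "M' = ms @ [ml]" using assms 1 by (cases M' rule: rev_cases) auto
  then show ?thesis using that assms 1 by auto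
qed

text \<open>Each entry contributes one up step, the 0 in the newly merged gap, and it starts at
  level -1. Hence the gaps carry the whole statistic \<open>length \<rho>\<close>.\<close>

lemma gaps_props:
  "adm r \<rho> \<Longrightarrow> length (gaps r \<rho>) = r + 1 \<and> (\<forall>n \<in> set (gaps r \<rho>). low n) \<and> sum_list (map ups (gaps r \<rho>)) = length \<rho>"
proof (induction \<rho> arbitrary: r)
  case Nil
  have "sum_list (map ups (replicate n [])) = 0" for n by (induction n) auto
  then show ?case by (simp only: gaps.simps) auto
next
  case (Cons a \<rho>)
  have IH: "length (gaps (a + 1) \<rho>) = a + 2" "\<forall>n \<in> set (gaps (a + 1) \<rho>). low n"
    "sum_list (map ups (gaps (a + 1) \<rho>)) = length \<rho>"
    using Cons by auto
  obtain m0 ms ml where M: "gaps (a + 1) \<rho> = m0 # ms @ [ml]" "length ms = a"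
    using IH(1) by (rule split_first_last)
  have "low (True # ml @ False # m0)"
    using IH(2) M low_flaw_neg[of ml "- 1"] by (auto simp: low_def)
  then show ?case
    using IH M Cons.prems by (auto simp: Let_def map_replicate_const sum_list_replicate)
qed

lemma fw_Cons: "fw (t # ts) = fw [t] @ fw ts"
  using fw_append[of "[t]" ts] by simp

lemma interleave_replicate: "interleave (replicate (length us) [] @ ns) (us @ ts) = fw us @ interleave ns ts"
proof (induction us)
  case (Cons u us)
  then show ?case by (simp add: fw_Cons[of u us] del: fw.simps)
qed simp

lemma interleave_snoc:
  "length ns = Suc (length ds) \<Longrightarrow> interleave (ns @ [n]) (ds @ [t]) = interleave ns ds @ fw [t] @ n"
proof (induction ds arbitrary: ns)
  case Nil
  then obtain m where "ns = [m]" by (auto simp: length_Suc_conv)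
  then show ?case by simp
next
  case (Cons d ds)
  then obtain m ms where "ns = m # ms" "length ms = Suc (length ds)" by (cases ns) auto
  then show ?case using Cons.IH[of ms] by simp
qed

lemma interleave_append_first: "interleave ((u @ n) # ns) ts = u @ interleave (n # ns) ts"
  by (cases ts) auto

lemma interleave_replicate_Nil: "interleave (replicate (Suc (length ts)) []) ts = fw ts"
  using interleave_replicate[of ts "[[]]" "[]"] by (simp add: replicate_append_same)

text \<open>The next label sits on the root created by the entry \<open>a\<close>. Starting there
  instead exchanges two blocks of the cyclic word: the children \<open>us\<close> of this root
  become excursions with empty gaps between them, and the old last and first gaps merge around the
  old starting 0.\<close>

lemma interleave_cyc:
  "adm (length cs) \<rho> \<Longrightarrow> cyc (False # interleave (gaps (length cs) \<rho>) cs) (False # fw (foldl grow cs \<rho>))"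
proof (induction \<rho> arbitrary: cs)
  case Nil
  then show ?case using interleave_replicate_Nil[of cs] by (simp add: cyc_refl)
next
  case (Cons a \<rho>)
  define ds where "ds = drop (length cs - a) cs"
  define us where "us = take (length cs - a) cs"
  have a: "a \<le> length cs" and adm: "adm (a + 1) \<rho>" using Cons.prems by auto
  have l: "length ds = a" "length us = length cs - a" using a by (simp_all add: ds_def us_def)
  have cs: "cs = us @ ds" and gr: "grow cs a = ds @ [Node us]"
    by (simp_all add: us_def ds_def grow_def)
  obtain m0 ms ml where M: "gaps (a + 1) \<rho> = m0 # ms @ [ml]" "length ms = a"
    using gaps_props[OF adm] split_first_last[of "gaps (a + 1) \<rho>" a] by auto
  define P where "P = interleave (m0 # ms) ds"
  define Q where "Q = fw us @ True # ml"
  have old: "interleave (gaps (a + 1) \<rho>) (grow cs a) = P @ False # Q"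
    using interleave_snoc[of "m0 # ms" ds ml "Node us"] M l by (simp add: gr P_def Q_def)
  have "interleave (gaps (length cs) (a # \<rho>)) cs
      = interleave (replicate (length us) [] @ ((True # ml @ [False]) @ m0) # ms) (us @ ds)"
    using M l by (simp add: Let_def flip: cs)
  also have "\<dots> = Q @ False # P"
    unfolding interleave_replicate interleave_append_first by (simp add: P_def Q_def)
  finally have new: "interleave (gaps (length cs) (a # \<rho>)) cs = Q @ False # P" .
  have "cyc (False # Q @ False # P) (False # P @ False # Q)"
    using cyc_swap[of "False # Q" "False # P"] by simp
  moreover have "cyc (False # P @ False # Q) (False # fw (foldl grow cs (a # \<rho>)))"
    using Cons.IH[of "grow cs a"] adm a unfolding old[symmetric] by (simp add: length_grow)
  ultimately show ?case unfolding new by (rule cyc_trans)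
qed

text \<open>Starting one level lower leaves the count of the gaps unchanged and adds the root of
  each tree, so the two statistics differ by the number of trees.\<close>

lemma flaw_interleave:
  assumes "\<forall>n \<in> set ns. low n" "length ns = Suc (length cs)"
  shows "hgt (interleave ns cs) = 0 \<and> flaw 0 (interleave ns cs) = sum_list (map ups ns) \<and>
    flaw (- 1) (interleave ns cs) = sum_list (map ups ns) + length cs"
  using assms
proof (induction cs arbitrary: ns)
  case Nil
  then obtain m where "ns = [m]" by (auto simp: length_Suc_conv)
  then show ?case using Nil.prems low_flaw_neg[of m] by (simp add: low_def)
next
  case (Cons t cs)
  then obtain m ms where ns: "ns = m # ms" "length ms = Suc (length cs)" by (cases ns) auto
  have "low m" using Cons.prems ns by simp
  then have "hgt m = 0" "flaw 0 m = ups m" "flaw (- 1) m = ups m"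
    using low_flaw_neg[of m] by (simp_all add: low_def)
  then show ?case using Cons.IH[of ms] Cons.prems ns
    by (simp add: flaw_fw_nonneg flaw_fw_minus_one del: fw.simps)
qed

text \<open>The leading 0 makes the empty forest the initial state, so that a k-germ has k steps.\<close>

definition queue :: "nat list \<Rightarrow> nat \<Rightarrow> tree list" where
  "queue \<alpha> p = foldl grow [] (take (Suc (length \<alpha>) - p) (0 # \<alpha>))"

definition path :: "nat list \<Rightarrow> nat \<Rightarrow> bool list" where
  "path \<alpha> p = interleave (gaps (length (queue \<alpha> p)) (drop (Suc (length \<alpha>) - p) (0 # \<alpha>))) (queue \<alpha> p)"

lemma path_props:
  assumes "adm 1 \<alpha>" "p \<le> Suc (length \<alpha>)"
  shows cyc_path: "cyc (False # path \<alpha> p) (\<theta> \<alpha>)" and hgt_path: "hgt (path \<alpha> p) = 0"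
    and flaw_path: "flaw 0 (path \<alpha> p) = p"
    and flaw_path_minus_one: "flaw (- 1) (path \<alpha> p) = p + length (queue \<alpha> p)"
proof -
  let ?\<beta> = "take (Suc (length \<alpha>) - p) (0 # \<alpha>)" and ?\<rho> = "drop (Suc (length \<alpha>) - p) (0 # \<alpha>)"
  have split: "0 # \<alpha> = ?\<beta> @ ?\<rho>" by (simp only: append_take_drop_id)
  have adm: "adm (length (queue \<alpha> p)) ?\<rho>"
    using adm_append[of "[]" ?\<beta> ?\<rho>] assms(1) by (simp only: queue_def split[symmetric]) simp
  have "foldl grow (queue \<alpha> p) ?\<rho> = foldl grow [] (0 # \<alpha>)"
    by (simp only: queue_def flip: foldl_append split)
  then show "cyc (False # path \<alpha> p) (\<theta> \<alpha>)"
    using interleave_cyc[OF adm] unfolding path_def \<theta>_eq[OF assms(1)] by simp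
  have "length ?\<rho> = p" using assms(2) by (simp only: length_drop list.size)
  then show "hgt (path \<alpha> p) = 0" "flaw 0 (path \<alpha> p) = p" 
    "flaw (- 1) (path \<alpha> p) = p + length (queue \<alpha> p)"
    using gaps_props[OF adm] flaw_interleave[of "gaps (length (queue \<alpha> p)) ?\<rho>" "queue \<alpha> p"]
    unfolding path_def by simp_all
qed

section \<open>Neighbors\<close>

lemma germ_of_cyclic_word:
  assumes "k > 1" "hgt x = 1" "length x = 2 * k + 1"
  obtains \<gamma> where "is_germ k \<gamma>" "cyc x (\<theta> \<gamma>)"
proof -
  obtain ts where ts: "cyc x (False # fw ts)" using cycle_lemma_exists[OF assms(2)] by blast
  obtain \<beta> where \<beta>: "adm 0 \<beta>" "foldl grow [] \<beta> = ts" using foldl_grow_surj by blast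
  have "length \<beta> = k"
    using cyc_length[OF ts] length_fw_foldl_grow[of "[]" \<beta>] \<beta>(2) assms(3) by simp
  then obtain \<gamma> where \<gamma>: "\<beta> = 0 # \<gamma>" "length \<gamma> = k - 1" using \<beta>(1) assms(1) by (cases \<beta>) auto
  then have adm: "adm 1 \<gamma>" and "is_germ k \<gamma>" using \<beta>(1) assms(1) by (simp_all add: is_germ_iff)
  moreover have "cyc x (\<theta> \<gamma>)" using ts \<beta>(2) \<gamma>(1) unfolding \<theta>_eq[OF adm] by simp
  ultimately show ?thesis using that by blast
qed

lemma \<theta>_cyc_inj:
  assumes "is_germ k \<gamma>" "is_germ k \<delta>" "cyc (\<theta> \<gamma>) (\<theta> \<delta>)"
  shows "\<gamma> = \<delta>"
proof -
  have "foldl grow [] (0 # \<gamma>) = foldl grow [] (0 # \<delta>)"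
    using assms cycle_lemma_unique unfolding is_germ_iff by (metis \<theta>_eq)
  then show ?thesis using foldl_grow_inj[of "[]" "0 # \<gamma>" "[]" "0 # \<delta>"] assms
    by (simp add: is_germ_iff)
qed

text \<open>Complementation turns the bit that was set to 1 back into a 0, so the resulting word is
  this 0 followed cyclically by the reversed path.\<close>

lemma neighbor_condition:
  assumes "adm 1 \<alpha>" "p \<le> Suc (length \<alpha>)"
  shows "cyclic_translate (cr ((\<theta> \<alpha>)[number_position \<alpha> p := True])) v \<longleftrightarrow> cyc (False # cr (path \<alpha> p)) v"
proof -
  obtain A B where AB: "F \<alpha> = A @ Some p # B" "bits B @ bits A = path \<alpha> p"
    using rotation_at_label[OF assms(1) cyc_path[OF assms]] flaw_path[OF assms] by metis
  have "number_position \<alpha> p = length A"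
    unfolding number_position_def
  proof (rule the_equality)
    show "length A < length (F \<alpha>) \<and> F \<alpha> ! length A = Some p" using AB by simp
  next
    fix q assume "q < length (F \<alpha>) \<and> F \<alpha> ! q = Some p"
    then have "F \<alpha> = take q (F \<alpha>) @ Some p # drop (Suc q) (F \<alpha>)" and "length (take q (F \<alpha>)) = q"
      using id_take_nth_drop[of q "F \<alpha>"] by auto
    then show "q = length A" using F_occurrence_unique[OF assms(1) AB(1)] by metis
  qed
  then have "cr ((\<theta> \<alpha>)[number_position \<alpha> p := True]) = cr (bits B) @ False # cr (bits A)"
    by (simp add: \<theta>_def AB(1) list_update_append cr_Cons)
  moreover have "False # cr (path \<alpha> p) = (False # cr (bits A)) @ cr (bits B)"
    by (simp flip: AB(2))
  ultimately show ?thesis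
    unfolding cyclic_translate_iff by (metis cyc_swap cyc_trans)
qed

text \<open>Complemented reversal keeps the statistic of a balanced path, so in the new germ the
  reversed path is again read from label \<open>p\<close>. Cyclic equivalence thereby becomes
  equality of words, and involutivity follows from \<open>cr_cr\<close>.\<close>

lemma neighbor_iff:
  assumes \<alpha>: "is_germ k \<alpha>" and p: "p \<le> k"
  shows "neighbor k \<alpha> p = \<gamma> \<longleftrightarrow> is_germ k \<gamma> \<and> path \<gamma> p = cr (path \<alpha> p)"
proof -
  have a: "adm 1 \<alpha>" "p \<le> Suc (length \<alpha>)" using \<alpha> p by (auto simp: is_germ_iff)
  let ?P = "\<lambda>\<gamma>. is_germ k \<gamma> \<and> cyc (False # cr (path \<alpha> p)) (\<theta> \<gamma>)"
  have P_iff: "?P \<gamma> \<longleftrightarrow> is_germ k \<gamma> \<and> path \<gamma> p = cr (path \<alpha> p)" for \<gamma>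
  proof (cases "is_germ k \<gamma>")
    case True
    then have g: "adm 1 \<gamma>" "p \<le> Suc (length \<gamma>)" using p by (auto simp: is_germ_iff)
    have "flaw 0 (cr (path \<alpha> p)) = flaw 0 (path \<gamma> p)"
      using flaw_cr_balanced[OF hgt_path[OF a]] flaw_path[OF a] flaw_path[OF g] by simp
    then show ?thesis using rotation_unique[OF g(1) _ cyc_path[OF g]] cyc_path[OF g] by metis
  qed simp
  have "length (path \<alpha> p) = 2 * k"
    using cyc_length[OF cyc_path[OF a]] \<alpha> length_fw_foldl_grow[of "[]" "0 # \<alpha>"]
    by (simp add: \<theta>_eq[OF a(1)] is_germ_iff)
  then obtain \<gamma>0 where \<gamma>0: "?P \<gamma>0"
    using germ_of_cyclic_word[of k "False # cr (path \<alpha> p)"] \<alpha> hgt_path[OF a]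
    by (auto simp: is_germ_iff)
  have uniq: "\<gamma> = \<gamma>0" if "?P \<gamma>" for \<gamma>
    using that \<gamma>0 \<theta>_cyc_inj cyc_trans cyc_sym by metis
  have "neighbor k \<alpha> p = (THE \<gamma>. ?P \<gamma>)"
    unfolding neighbor_def neighbor_condition[OF a] ..
  also have "\<dots> = \<gamma>0" using \<gamma>0 by (rule the_equality) (rule uniq)
  finally have "neighbor k \<alpha> p = \<gamma>0" .
  then have "neighbor k \<alpha> p = \<gamma> \<longleftrightarrow> ?P \<gamma>" using \<gamma>0 uniq[of \<gamma>] by blast
  then show ?thesis unfolding P_iff .
qed

lemma is_germ_neighbor: "is_germ k \<alpha> \<Longrightarrow> p \<le> k \<Longrightarrow> is_germ k (neighbor k \<alpha> p)"
  and path_neighbor: "is_germ k \<alpha> \<Longrightarrow> p \<le> k \<Longrightarrow> path (neighbor k \<alpha> p) p = cr (path \<alpha> p)"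
  using iffD1[OF neighbor_iff refl] by simp_all

lemma neighbor_neighbor:
  assumes "is_germ k \<alpha>" "p \<le> k"
  shows "neighbor k (neighbor k \<alpha> p) p = \<alpha>"
  unfolding neighbor_iff[OF is_germ_neighbor[OF assms] assms(2)] path_neighbor[OF assms]
  using assms(1) by simp

lemma is_germ_Cons_0: "k > 1 \<Longrightarrow> is_germ (Suc k) (0 # \<alpha>) \<longleftrightarrow> is_germ k \<alpha>"
  by (auto simp: is_germ_iff)

lemma length_queue:
  assumes "adm 1 \<alpha>" "p < length \<alpha>"
  shows "length (queue \<alpha> p) = entry \<alpha> (p + 1) + 1"
proof -
  define m where "m = length \<alpha> - Suc p"
  have m: "m < length \<alpha>" "Suc (length \<alpha>) - p = Suc (Suc m)" using assms(2) by (auto simp: m_def)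
  define \<beta> where "\<beta> = 0 # take m \<alpha>"
  have t: "take (Suc (length \<alpha>) - p) (0 # \<alpha>) = \<beta> @ [\<alpha> ! m]"
    using m(1) unfolding m(2) by (simp add: \<beta>_def take_Suc_conv_app_nth)
  have "0 # \<alpha> = \<beta> @ \<alpha> ! m # drop (Suc m) \<alpha>"
    using id_take_nth_drop[OF m(1)] by (simp add: \<beta>_def)
  then have "adm (length ([] :: tree list)) (\<beta> @ \<alpha> ! m # drop (Suc m) \<alpha>)"
    using assms(1) by (metis One_nat_def add_0 adm.simps(2) le_refl list.size(3) plus_1_eq_Suc add.commute)
  then have "\<alpha> ! m \<le> length (foldl grow [] \<beta>)"
    unfolding adm_append by simp
  then show ?thesis
    unfolding queue_def t by (simp add: length_grow entry_def m_def)
qed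

text \<open>For a balanced path, reversal preserves the statistic from level -1 as well as from
  level 0, hence also their difference, the queue length.\<close>

lemma neighbor_preserves_entry:
  assumes "is_germ k \<alpha>" "p < k - 1"
  shows "entry (neighbor k \<alpha> p) (p + 1) = entry \<alpha> (p + 1)"
proof -
  let ?\<gamma> = "neighbor k \<alpha> p"
  have p: "p \<le> k" using assms by simp
  have g: "is_germ k ?\<gamma>" using is_germ_neighbor[OF assms(1) p] .
  have "flaw (- 1) (path ?\<gamma> p) = flaw (- 1) (path \<alpha> p)"
    unfolding path_neighbor[OF assms(1) p]
    by (rule flaw_cr_balanced, rule hgt_path) (use assms in \<open>auto simp: is_germ_iff\<close>)
  then have "length (queue ?\<gamma> p) = length (queue \<alpha> p)"
    using assms g flaw_path_minus_one[of ?\<gamma> p] flaw_path_minus_one[of \<alpha> p] by (simp add: is_germ_iff)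
  then show ?thesis
    using assms g length_queue[of ?\<gamma> p] length_queue[of \<alpha> p] by (simp add: is_germ_iff)
qed

lemma gaps_1_two:
  assumes "adm 1 \<alpha>"
  obtains m n where "gaps 1 \<alpha> = [m, n]" "low m" "low n"
proof -
  have l: "length (gaps 1 \<alpha>) = 0 + 2" and low: "\<forall>n \<in> set (gaps 1 \<alpha>). low n" using gaps_props[OF assms] by auto
  obtain m ms n where "gaps 1 \<alpha> = m # ms @ [n]" "length ms = 0" using split_first_last[OF l] .
  then show ?thesis using that low by simp
qed

subsection \<open>Column \<open>\<alpha>\<^sup>k\<close>\<close>

text \<open>With no step done the forest is empty and the path is a single gap. The wrapping by 1
  and 0 is invariant under complemented reversal.\<close>

lemma path_top_Cons_0:
  assumes "adm 1 \<alpha>"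
  shows "path (0 # \<alpha>) (Suc (Suc (length \<alpha>))) = True # path \<alpha> (Suc (length \<alpha>)) @ [False]"
proof -
  obtain m n where "gaps 1 \<alpha> = [m, n]" using gaps_1_two[OF assms] .
  then show ?thesis by (simp add: path_def queue_def Let_def)
qed

lemma neighbor_top_Cons_0:
  assumes "is_germ k \<alpha>"
  shows "neighbor (Suc k) (0 # \<alpha>) (Suc k) = 0 # neighbor k \<alpha> k"
proof -
  have k: "k > 1" using assms by (simp add: is_germ_iff)
  have top: "path (0 # \<beta>) (Suc k) = True # path \<beta> k @ [False]" if "is_germ k \<beta>" for \<beta>
    using path_top_Cons_0[of \<beta>] that by (simp add: is_germ_iff)
  have g: "is_germ k (neighbor k \<alpha> k)" using is_germ_neighbor[OF assms] by simp
  have "path (0 # neighbor k \<alpha> k) (Suc k) = cr (path (0 # \<alpha>) (Suc k))"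
    using path_neighbor[OF assms, of k] by (simp add: top assms g cr_Cons)
  then show ?thesis
    using neighbor_iff[of "Suc k" "0 # \<alpha>" "Suc k"] is_germ_Cons_0[OF k] assms g by simp
qed

lemma neighbor_top_hd_0:
  assumes "is_germ k \<alpha>" "hd \<alpha> = 0"
  shows "hd (neighbor k \<alpha> k) = 0"
proof -
  have l: "length \<alpha> = k - 1" "k > 1" using assms by (auto simp: is_germ_iff)
  then obtain \<alpha>' where \<alpha>: "\<alpha> = 0 # \<alpha>'" using assms(2) by (cases \<alpha>) auto
  show ?thesis
  proof (cases "\<alpha>' = []")
    \<comment> \<open>Stripping the 0 would leave no germ here, so \<open>k = 2\<close> is computed
      directly.\<close>
    case True
    then have k: "k = 2" using l \<alpha> by simp
    have "path [0] 2 = [True, True, False, False]" by (simp add: path_def queue_def Let_def)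
    then have "neighbor 2 [0] 2 = [0]"
      using neighbor_iff[of 2 "[0]" 2 "[0]"] assms(1) \<alpha> True k by (simp add: cr_Cons)
    then show ?thesis using \<alpha> True k by simp
  next
    case False
    then have "k - 1 > 1" "Suc (k - 1) = k" using l \<alpha> by (cases \<alpha>'; simp)+
    then show ?thesis
      using neighbor_top_Cons_0[of "k - 1" \<alpha>'] is_germ_Cons_0[of "k - 1" \<alpha>'] assms(1) \<alpha> by simp
  qed
qed

text \<open>The leading entry is 0 or 1. A 0 stays 0, and by involutivity a 1 cannot become
  0.\<close>

lemma neighbor_top_preserves_entry:
  assumes "is_germ k \<alpha>"
  shows "entry (neighbor k \<alpha> k) (k - 1) = entry \<alpha> (k - 1)"
proof -
  let ?\<gamma> = "neighbor k \<alpha> k"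
  have g: "is_germ k ?\<gamma>" using is_germ_neighbor[OF assms] by simp
  have e: "entry \<beta> (k - 1) = hd \<beta> \<and> hd \<beta> \<le> 1" if "is_germ k \<beta>" for \<beta>
    using that by (cases \<beta>) (auto simp: is_germ_iff entry_def)
  have "hd ?\<gamma> = 0 \<longleftrightarrow> hd \<alpha> = 0"
    using neighbor_top_hd_0[OF assms] neighbor_top_hd_0[OF g] neighbor_neighbor[OF assms, of k] by auto
  then show ?thesis using e[OF assms] e[OF g] by linarith
qed

subsection \<open>Column \<open>\<alpha>\<^bsup>k-1\<^esup>\<close>\<close>

lemma low_cr: "low n \<Longrightarrow> low (cr n)"
  using ups_hgt[of n] ups_hgt[of "cr n"] flaw_cr_balanced[of n 0] by (simp add: low_def)

lemma low_no_up_from_0: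
  assumes "low (x @ False # z)" "hgt x = 0" shows False
  using assms flaw_le_ups[of 0 x] flaw_le_ups[of 1 z] by (simp add: low_def)

text \<open>A low word has no up step from level 0, so the first such step marks where it
  ends.\<close>

lemma low_split_unique:
  assumes "low m" "low m'" "m @ False # y = m' @ False # y'"
  shows "m = m' \<and> y = y'"
proof -
  have *: "u = []" if h: "low a" "low (a @ u)" "False # v = u @ False # w" for a u v w
  proof (rule ccontr)
    assume "u \<noteq> []"
    then obtain z where "u = False # z" using h(3) by (cases u) auto
    then show False using low_no_up_from_0[of a z] h by (simp add: low_def)
  qed
  from assms(3) consider u where "m = m' @ u" "u @ False # y = False # y'"
    | u where "m @ u = m'" "False # y = u @ False # y'"
    unfolding append_eq_append_conv2 by blast
  then show ?thesis
  proof cases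
    case 1 then show ?thesis using *[of m' u y' y] assms by simp
  next
    case 2 then show ?thesis using *[of m u y y'] assms by simp
  qed
qed

text \<open>The same entries remain to be processed in both cases, so the gaps agree. Only the one
  tree differs: a leaf after the step 0, a root with one leaf after 0, 0.\<close>

lemma path_subtop:
  assumes "is_germ k \<alpha>" "gaps 1 \<alpha> = [m, n]"
  shows "path \<alpha> (k - 1) = m @ [False, True] @ n"
    and "path (0 # \<alpha>) (k - 1) = m @ [False, False, True, True] @ n"
proof -
  have k: "k > 1" "length \<alpha> = k - 1" using assms by (auto simp: is_germ_iff)
  then have "Suc (k - 1) - (k - 1) = Suc 0" "Suc (Suc (k - 1)) - (k - 1) = Suc (Suc 0)" by simp_all
  then show "path \<alpha> (k - 1) = m @ [False, True] @ n"
    "path (0 # \<alpha>) (k - 1) = m @ [False, False, True, True] @ n"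
    using assms(2) k by (simp_all add: path_def queue_def grow_def del: gaps.simps)
qed

text \<open>The words 01 and 0011 are both fixed by \<open>cr\<close>. By unique splitting the
  neighbor's gaps are therefore \<open>cr n\<close> and \<open>cr m\<close>, whichever of the two
  words stands in the middle.\<close>

lemma neighbor_subtop_Cons_0:
  assumes "is_germ k \<alpha>"
  shows "neighbor (Suc k) (0 # \<alpha>) (k - 1) = 0 # neighbor k \<alpha> (k - 1)"
proof -
  let ?\<gamma> = "neighbor k \<alpha> (k - 1)"
  have k: "k > 1" using assms by (simp add: is_germ_iff)
  have g: "is_germ k ?\<gamma>" using is_germ_neighbor[OF assms] by simp
  obtain m n where mn: "gaps 1 \<alpha> = [m, n]" "low m" "low n"
    using gaps_1_two assms unfolding is_germ_iff by blast
  obtain m' n' where mn': "gaps 1 ?\<gamma> = [m', n']" "low m'" "low n'"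
    using gaps_1_two g unfolding is_germ_iff by blast
  have "m' @ False # True # n' = cr n @ False # True # cr m"
    using path_neighbor[OF assms, of "k - 1"] path_subtop(1)[OF assms mn(1)] path_subtop(1)[OF g mn'(1)]
    by (simp add: cr_Cons)
  then have "m' = cr n \<and> n' = cr m"
    using low_split_unique[of m' "cr n"] mn mn' low_cr by blast
  then have "path (0 # ?\<gamma>) (k - 1) = cr (path (0 # \<alpha>) (k - 1))"
    using path_subtop(2)[OF assms mn(1)] path_subtop(2)[OF g mn'(1)] by (simp add: cr_Cons)
  then show ?thesis
    using neighbor_iff[of "Suc k" "0 # \<alpha>" "k - 1"] is_germ_Cons_0[OF k] assms g by simp
qed

text \<open>A leading 0 makes the first gap empty and the second nonempty, while reversal exchanges
  the gaps.\<close>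

lemma neighbor_subtop_flips_first_entry:
  assumes "is_germ k \<alpha>" "hd \<alpha> = 0"
  shows "hd (neighbor k \<alpha> (k - 1)) \<noteq> 0"
proof
  let ?\<gamma> = "neighbor k \<alpha> (k - 1)"
  assume 0: "hd ?\<gamma> = 0"
  have g: "is_germ k ?\<gamma>" using is_germ_neighbor[OF assms(1)] by simp
  have N0: "\<exists>n. gaps 1 \<beta> = [[], n] \<and> n \<noteq> [] \<and> low n" if germ: "is_germ k \<beta>" and hd: "hd \<beta> = 0" for \<beta>
  proof -
    obtain \<beta>' where \<beta>: "\<beta> = 0 # \<beta>'" "adm 1 \<beta>'" using germ hd by (cases \<beta>) (auto simp: is_germ_iff)
    obtain m n where "gaps 1 \<beta>' = [m, n]" using gaps_1_two[OF \<beta>(2)] .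
    then have "gaps 1 \<beta> = [[], True # n @ False # m]" by (simp add: \<beta>(1) Let_def)
    moreover have "low (True # n @ False # m)"
      using gaps_props[of 1 \<beta>] germ calculation by (simp add: is_germ_iff)
    ultimately show ?thesis by blast
  qed
  obtain n where n: "gaps 1 \<alpha> = [[], n]" "n \<noteq> []" "low n" using N0[OF assms] by blast
  obtain n' where n': "gaps 1 ?\<gamma> = [[], n']" using N0[OF g 0] by blast
  have "[] @ False # True # n' = cr n @ False # [True]"
    using path_neighbor[OF assms(1), of "k - 1"] path_subtop(1)[OF assms(1) n(1)] path_subtop(1)[OF g n']
    by (simp add: cr_Cons)
  then have "cr n = []" using low_split_unique[of "[]" "cr n"] low_cr n(3) low_Nil by metis
  then show False using n(2) length_cr[of n] by simp
qed

section \<open>Counting and indexing germs\<close>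

text \<open>Counts admissible sequences of length \<open>n\<close> with first bound
  \<open>r\<close>, splitting on whether the first entry attains the bound.\<close>

fun ballot :: "nat \<Rightarrow> nat \<Rightarrow> nat" where
  "ballot 0 r = 1"
| "ballot (Suc n) 0 = ballot n 1"
| "ballot (Suc n) (Suc r) = ballot (Suc n) r + ballot n (r + 2)"

text \<open>The ballot numbers (r+1)(2n+r)!/(n!(n+r+1)!), cleared of denominators; r = 1 and n = k-1
  give the Catalan number C_k.\<close>

lemma ballot_formula: "ballot n r * (fact n * fact (n + r + 1)) = (r + 1) * (fact (2 * n + r) :: nat)"
proof (induction n r rule: ballot.induct)
  case (2 n)
  have "ballot (Suc n) 0 * (fact (Suc n) * fact (Suc n + 0 + 1)) = (n + 1) * (ballot n 1 * (fact n * fact (n + 1 + 1)))"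
    by (simp add: algebra_simps)
  also have "\<dots> = (n + 1) * (2 * fact (2 * n + 1))" unfolding 2 by simp
  also have "\<dots> = (0 + 1) * fact (2 * Suc n + 0)" by (simp add: algebra_simps)
  finally show ?case .
next
  case (3 n r)
  define f where "f = (fact (2 * n + r + 2) :: nat)"
  have 1: "ballot (Suc n) r * (fact (Suc n) * fact (n + r + 2)) = (r + 1) * f"
    using 3(1) by (simp add: f_def)
  have 2: "ballot n (r + 2) * (fact n * fact (n + r + 3)) = (r + 3) * f"
    using 3(2) by (simp add: f_def add.assoc eval_nat_numeral)
  have s: "fact (Suc n + Suc r + 1) = (n + r + 3) * (fact (n + r + 2) :: nat)"
    "fact (n + r + 3) = (n + r + 3) * (fact (n + r + 2) :: nat)"
    by (simp_all add: eval_nat_numeral)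
  have "ballot (Suc n) (Suc r) * (fact (Suc n) * fact (Suc n + Suc r + 1))
     = (n + r + 3) * (ballot (Suc n) r * (fact (Suc n) * fact (n + r + 2)))
     + (n + 1) * (ballot n (r + 2) * (fact n * fact (n + r + 3)))"
    unfolding s by (simp add: algebra_simps)
  also have "\<dots> = (n + r + 3) * ((r + 1) * f) + (n + 1) * ((r + 3) * f)"
    unfolding 1 2 ..
  also have "\<dots> = (Suc r + 1) * ((2 * n + r + 3) * f)"
    by (simp add: algebra_simps)
  also have "(2 * n + r + 3) * f = fact (2 * Suc n + Suc r)"
    by (simp add: f_def eval_nat_numeral)
  finally show ?case .
qed simp

lemma finite_card_adm:
  "finite {\<alpha>. length \<alpha> = n \<and> adm r \<alpha>} \<and> card {\<alpha>. length \<alpha> = n \<and> adm r \<alpha>} = ballot n r"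
proof (induction n r rule: ballot.induct)
  case (1 r)
  have "{\<alpha>. length \<alpha> = 0 \<and> adm r \<alpha>} = {[]}" by auto
  then show ?case by simp
next
  case (2 n)
  have "{\<alpha>. length \<alpha> = Suc n \<and> adm 0 \<alpha>} = Cons 0 ` {\<alpha>. length \<alpha> = n \<and> adm 1 \<alpha>}"
    by (auto simp: length_Suc_conv)
  then show ?case using 2 by (simp add: card_image)
next
  case (3 n r)
  let ?A = "{\<alpha>. length \<alpha> = Suc n \<and> adm r \<alpha>}" and ?B = "Cons (Suc r) ` {\<alpha>. length \<alpha> = n \<and> adm (r + 2) \<alpha>}"
  have "{\<alpha>. length \<alpha> = Suc n \<and> adm (Suc r) \<alpha>} = ?A \<union> ?B"
    by (auto simp: length_Suc_conv le_Suc_eq)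
  moreover have "?A \<inter> ?B = {}" by auto
  ultimately show ?case using 3 by (simp add: card_Un_disjoint card_image)
qed

lemma finite_germs: "finite {\<alpha>. is_germ k \<alpha>}"
  using finite_card_adm[of "k - 1" 1] by (auto intro: rev_finite_subset simp: is_germ_iff)

lemma card_germs:
  assumes "k > 1"
  shows "card {\<alpha>. is_germ k \<alpha>} = catalan k"
proof -
  define n where "n = k - 1"
  have k: "k = Suc n" using assms by (simp add: n_def)
  have "card {\<alpha>. is_germ k \<alpha>} = ballot n 1"
    using finite_card_adm[of n 1] assms by (simp add: is_germ_iff n_def)
  moreover have "ballot n 1 * (fact k * fact (k + 1)) = k * (ballot n 1 * (fact n * fact (n + 1 + 1)))"
    by (simp add: k algebra_simps)
  moreover have "\<dots> = k * (2 * fact (2 * n + 1))" unfolding ballot_formula by simp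
  moreover have "\<dots> = fact (2 * k)" by (simp add: k algebra_simps)
  moreover have "(fact k * fact (k + 1) :: nat) > 0" by simp
  ultimately show ?thesis
    unfolding catalan_def by (metis nonzero_mult_div_cancel_right less_numeral_extra(3))
qed

lemma bij_betw_rank:
  assumes "finite A"
    and irrefl: "\<And>x. \<not> R x x"
    and trans: "\<And>x y z. R x y \<Longrightarrow> R y z \<Longrightarrow> R x z"
    and total: "\<And>x y. x \<in> A \<Longrightarrow> y \<in> A \<Longrightarrow> x \<noteq> y \<Longrightarrow> R x y \<or> R y x"
  shows "bij_betw (\<lambda>x. card {y \<in> A. R y x}) A {0..<card A}"
proof -
  let ?f = "\<lambda>x. card {y \<in> A. R y x}"
  have less: "?f x < ?f y" if "x \<in> A" "R x y" for x y
  proof (rule psubset_card_mono)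
    have "x \<in> {z \<in> A. R z y}" "x \<notin> {z \<in> A. R z x}" using that irrefl[of x] by simp_all
    moreover have "{z \<in> A. R z x} \<subseteq> {z \<in> A. R z y}"
      using trans[OF _ that(2)] by (intro Collect_mono) simp
    ultimately show "{z \<in> A. R z x} \<subset> {z \<in> A. R z y}" by blast
  qed (use assms(1) in simp)
  have inj: "inj_on ?f A"
  proof (rule inj_onI, rule ccontr)
    fix x y assume "x \<in> A" "y \<in> A" "?f x = ?f y" "x \<noteq> y"
    then show False using total[of x y] less[of x y] less[of y x] by auto
  qed
  have "?f ` A \<subseteq> {0..<card A}"
  proof
    fix n assume "n \<in> ?f ` A"
    then obtain x where x: "x \<in> A" "n = ?f x" by blast
    have "{y \<in> A. R y x} \<subset> A" using x(1) irrefl[of x] by blast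
    then show "n \<in> {0..<card A}" using x assms(1) psubset_card_mono by auto
  qed
  moreover have "card (?f ` A) = card {0..<card A}" using inj by (simp add: card_image)
  ultimately have "?f ` A = {0..<card A}" by (intro card_subset_eq) auto
  then show ?thesis using inj by (simp add: bij_betw_def)
qed

lemma bij_betw_germ_index:
  assumes "k > 1"
  shows "bij_betw (germ_index k) {\<alpha>. is_germ k \<alpha>} {0..<catalan k}"
proof -
  have "bij_betw (\<lambda>\<alpha>. card {\<beta> \<in> {\<alpha>. is_germ k \<alpha>}. germ_less \<beta> \<alpha>}) {\<alpha>. is_germ k \<alpha>} {0..<card {\<alpha>. is_germ k \<alpha>}}"
  proof (rule bij_betw_rank[OF finite_germs])
    show "\<not> germ_less \<alpha> \<alpha>" for \<alpha>
      unfolding germ_less_def lexord_lex using lexord_irreflexive[of less_than] by simp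
    show "germ_less \<alpha> \<gamma>" if "germ_less \<alpha> \<beta>" "germ_less \<beta> \<gamma>" for \<alpha> \<beta> \<gamma>
      using that lexord_trans[of \<alpha> \<beta> less_than \<gamma>] unfolding germ_less_def lexord_lex by simp
    show "germ_less \<alpha> \<beta> \<or> germ_less \<beta> \<alpha>"
      if "\<alpha> \<in> {\<alpha>. is_germ k \<alpha>}" "\<beta> \<in> {\<alpha>. is_germ k \<alpha>}" "\<alpha> \<noteq> \<beta>" for \<alpha> \<beta>
    proof -
      have "(a, b) \<in> less_than \<or> a = b \<or> (b, a) \<in> less_than" for a b by auto
      then have "(\<alpha>, \<beta>) \<in> lexord less_than \<or> \<alpha> = \<beta> \<or> (\<beta>, \<alpha>) \<in> lexord less_than"
        by (intro lexord_linear) blast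
      then show ?thesis using that unfolding germ_less_def lexord_lex by (simp add: is_germ_iff)
    qed
  qed
  then show ?thesis using card_germs[OF assms] by (simp add: germ_index_def[abs_def])
qed

lemma germ_index_less: "is_germ k \<alpha> \<Longrightarrow> germ_index k \<alpha> < catalan k"
  using bij_betw_apply[OF bij_betw_germ_index, of k \<alpha>] by (simp add: is_germ_iff)

lemma germ_at_germ_index:
  assumes "is_germ k \<alpha>" shows "germ_at k (germ_index k \<alpha>) = \<alpha>"
proof -
  have "inj_on (germ_index k) {\<alpha>. is_germ k \<alpha>}"
    using assms bij_betw_germ_index by (auto simp: bij_betw_def is_germ_iff)
  then show ?thesis
    unfolding germ_at_def using assms by (intro the_equality) (auto dest: inj_onD)
qed

lemma germ_at:
  assumes "k > 1" "m < catalan k"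
  shows "is_germ k (germ_at k m)" "germ_index k (germ_at k m) = m"
proof -
  obtain \<alpha> where "is_germ k \<alpha>" "m = germ_index k \<alpha>"
    using bij_betw_germ_index[OF assms(1)] assms(2) unfolding bij_betw_def
    by (metis (mono_tags, lifting) atLeastLessThan_iff imageE le0 mem_Collect_eq)
  then show "is_germ k (germ_at k m)" "germ_index k (germ_at k m) = m"
    using germ_at_germ_index by simp_all
qed

text \<open>A germ below \<open>0 # \<alpha>\<close> also starts with 0, so prefixing 0 matches the
  two initial segments.\<close>

lemma germ_index_Cons_0:
  assumes "k > 1"
  shows "germ_index (Suc k) (0 # \<alpha>) = germ_index k \<alpha>"
proof -
  have "{\<beta>. is_germ (Suc k) \<beta> \<and> germ_less \<beta> (0 # \<alpha>)} = Cons 0 ` {\<beta>. is_germ k \<beta> \<and> germ_less \<beta> \<alpha>}"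
    (is "?L = ?R")
  proof
    show "?L \<subseteq> ?R"
    proof
      fix \<beta> assume \<beta>: "\<beta> \<in> ?L"
      then obtain b \<beta>' where b: "\<beta> = b # \<beta>'" by (cases \<beta>) (auto simp: germ_less_def)
      then have "b = 0" "germ_less \<beta>' \<alpha>" using \<beta> by (auto simp: germ_less_def)
      then show "\<beta> \<in> ?R" using \<beta> b is_germ_Cons_0[OF assms] by auto
    qed
    show "?R \<subseteq> ?L" using is_germ_Cons_0[OF assms] by (auto simp: germ_less_def)
  qed
  then show ?thesis by (simp add: germ_index_def card_image)
qed

lemma catalan_le_Suc:
  assumes "k > 1" shows "catalan k \<le> catalan (Suc k)"
proof -
  have "card (Cons 0 ` {\<alpha>. is_germ k \<alpha>}) \<le> card {\<alpha>. is_germ (Suc k) \<alpha>}"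
    using is_germ_Cons_0[OF assms] by (intro card_mono finite_germs) auto
  then show ?thesis using assms by (simp add: card_image card_germs)
qed

lemma catalan_mono:
  assumes "1 < i" "i \<le> j"
  shows "catalan i \<le> catalan j"
  using assms(2)
proof (induction j rule: dec_induct)
  case (step j)
  then show ?case using catalan_le_Suc[of j] assms(1) by simp
qed simp

lemma germ_at_Cons_0:
  assumes "k > 1" "m < catalan k"
  shows "germ_at (Suc k) m = 0 # germ_at k m"
  using germ_at_germ_index[of "Suc k" "0 # germ_at k m"] germ_at[OF assms]
  by (simp only: germ_index_Cons_0 is_germ_Cons_0 assms(1))

lemma hd_germ_eq_0:
  assumes "k > 1" "is_germ (Suc k) \<alpha>" "germ_index (Suc k) \<alpha> < catalan k"
  shows "hd \<alpha> = 0"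
  using germ_at_germ_index[OF assms(2)] germ_at_Cons_0[OF assms(1,3)] by (metis list.sel(1))

section \<open>The columns\<close>

lemma CAT_column_less:
  assumes "k > 1" "m < catalan k" "p \<le> k"
  shows "CAT_column k p m < catalan k"
  unfolding CAT_column_def CAT_def
  by (rule germ_index_less[OF is_germ_neighbor[OF germ_at(1)[OF assms(1,2)] assms(3)]])

lemma CAT_column_CAT_column:
  assumes "k > 1" "m < catalan k" "p \<le> k"
  shows "CAT_column k p (CAT_column k p m) = m"
  using is_germ_neighbor[OF germ_at(1)[OF assms(1,2)] assms(3)] germ_at[OF assms(1,2)] assms(3)
  by (simp add: CAT_column_def CAT_def germ_at_germ_index neighbor_neighbor)

lemma involutive_permutation_CAT_column:
  assumes "k > 1" "p \<le> k"
  shows "involutive_permutation (catalan k) (CAT_column k p)"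
  unfolding involutive_permutation_def
proof
  show "bij_betw (CAT_column k p) {0..<catalan k} {0..<catalan k}"
    by (rule bij_betw_byWitness[where f' = "CAT_column k p"])
      (use CAT_column_less[OF assms(1) _ assms(2)] CAT_column_CAT_column[OF assms(1) _ assms(2)] in auto)
  show "\<forall>m<catalan k. CAT_column k p (CAT_column k p m) = m"
    using CAT_column_CAT_column[OF assms(1) _ assms(2)] by blast
qed

lemma CAT_top_Suc:
  assumes "k > 1" "m < catalan k"
  shows "CAT (Suc k) m (Suc k) = 0 # CAT k m k"
    and "CAT_column (Suc k) (Suc k) m = CAT_column k k m"
  using neighbor_top_Cons_0[OF germ_at(1)[OF assms]]
  by (simp_all only: CAT_column_def CAT_def germ_at_Cons_0[OF assms] germ_index_Cons_0[OF assms(1)])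

lemma CAT_column_subtop_Suc:
  assumes "k > 1" "m < catalan k"
  shows "CAT_column (Suc k) (k - 1) m = CAT_column k (k - 1) m"
  using neighbor_subtop_Cons_0[OF germ_at(1)[OF assms]]
  by (simp only: CAT_column_def CAT_def germ_at_Cons_0[OF assms] germ_index_Cons_0[OF assms(1)])

lemma CAT_column_subtop_ge:
  assumes "k > 2" "m < catalan (k - 1)"
  shows "catalan (k - 1) \<le> CAT_column k (k - 1) m"
proof (rule ccontr)
  assume "\<not> catalan (k - 1) \<le> CAT_column k (k - 1) m"
  moreover have k: "k - 1 > 1" "Suc (k - 1) = k" using assms(1) by simp_all
  have m: "m < catalan k" using catalan_le_Suc[OF k(1)] assms(2) k(2) by simp
  then have g: "is_germ k (germ_at k m)" using germ_at assms(1) by simp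
  have "hd (germ_at k m) = 0" using germ_at_Cons_0[OF k(1) assms(2)] k(2) by simp
  then have "hd (neighbor k (germ_at k m) (k - 1)) \<noteq> 0"
    by (rule neighbor_subtop_flips_first_entry[OF g])
  ultimately show False
    using hd_germ_eq_0[OF k(1), of "neighbor k (germ_at k m) (k - 1)"] is_germ_neighbor[OF g, of "k - 1"] k(2)
    by (simp add: CAT_column_def CAT_def)
qed

lemma rgs_Cons_0: "\<alpha> \<noteq> [] \<Longrightarrow> rgs (0 # \<alpha>) = rgs \<alpha>"
  by (simp add: rgs_def)

section \<open>Limit sequences of compatible columns, and determination by an upper part\<close>

text \<open>Each term of a limit sequence is read off in the first table that has its row.\<close>

definition least_table :: "nat \<Rightarrow> nat" where
  "least_table m = (LEAST k. 1 < k \<and> m < catalan k)"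

lemma least_table:
  assumes "1 < k" "m < catalan k"
  shows "1 < least_table m" "m < catalan (least_table m)" "least_table m \<le> k"
  unfolding least_table_def using LeastI[of "\<lambda>k. 1 < k \<and> m < catalan k" k] Least_le[of "\<lambda>k. 1 < k \<and> m < catalan k" k] assms
  by auto

lemma compatible_family:
  assumes step: "\<And>k m. 1 < k \<Longrightarrow> m < catalan k \<Longrightarrow> f (Suc k) m = f k m"
    and "1 < k" "m < catalan k"
  shows "f k m = f (least_table m) m"
proof -
  have "least_table m \<le> k" using least_table assms by blast
  then show ?thesis
  proof (induction k rule: dec_induct)
    case (step j)
    have "m < catalan j"
      using catalan_mono[OF _ step.hyps(1)] least_table[OF assms(2,3)] by simp
    then show ?case using step assms(1)[of j m] least_table(1)[OF assms(2,3)] by simp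
  qed simp
qed

lemma least_table_eq:
  assumes "k > 2" "catalan (k - 1) \<le> m" "m < catalan k"
  shows "least_table m = k"
proof (rule ccontr)
  note l = least_table[of k m]
  assume "least_table m \<noteq> k"
  then have "least_table m \<le> k - 1" using l assms by simp
  then show False using catalan_mono[of "least_table m" "k - 1"] l assms by simp
qed

definition S1_seq :: "nat \<Rightarrow> nat" where
  "S1_seq m = CAT_column (least_table m) (least_table m - 1) m"

lemma map_S1_part:
  assumes "k > 2"
  shows "map S1_seq [catalan (k - 1)..<catalan k] = S1_part k"
  using assms least_table_eq[OF assms] by (auto simp: S1_part_def S1_seq_def)

lemma is_S1_S1_seq: "is_S1 S1_seq"
  unfolding is_S1_def
proof (intro allI impI)
  fix k :: nat assume "1 < k"
  then have "2 \<le> k" by simp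
  then show "map S1_seq [0..<catalan k] = concat (map S1_part [2..<k + 1])"
  proof (induction k rule: dec_induct)
    case base
    have "least_table m = 2" if "m < catalan 2" for m using least_table[of 2 m] that by simp
    then show ?case by (simp add: S1_part_def S1_seq_def)
  next
    case (step k)
    have "catalan (Suc k) = catalan k + (catalan (Suc k) - catalan k)" using catalan_le_Suc[of k] step.hyps by simp
    then have "[0..<catalan (Suc k)] = [0..<catalan k] @ [catalan k..<catalan (Suc k)]"
      by (metis upt_add_eq_append le0)
    then show ?case using step map_S1_part[of "Suc k"] by simp
  qed
qed

lemma involutive_permutation_cong:
  assumes "involutive_permutation n \<sigma>" "\<And>m. m < n \<Longrightarrow> \<sigma> m = \<tau> m"
  shows "involutive_permutation n \<tau>"
proof -
  have "\<sigma> m < n" if "m < n" for m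
    using assms(1) that bij_betw_apply[of \<sigma> "{0..<n}" "{0..<n}" m] unfolding involutive_permutation_def by simp
  then show ?thesis
    using assms bij_betw_cong[of "{0..<n}" \<sigma> \<tau>] unfolding involutive_permutation_def by auto
qed

text \<open>A row \<open>m\<close> below \<open>c\<close> has its partner \<open>\<tau> m\<close> in
  the known part, where \<open>\<sigma>\<close> maps it back to \<open>m\<close>; applying
  \<open>\<sigma>\<close> once more gives the value at \<open>m\<close>.\<close>

lemma involution_determined:
  assumes \<sigma>: "involutive_permutation n \<sigma>" and \<tau>: "involutive_permutation n \<tau>"
    and eq: "\<forall>m \<in> {c..<n}. \<sigma> m = \<tau> m" and up: "\<And>m. m < c \<Longrightarrow> m < n \<Longrightarrow> c \<le> \<tau> m"
    and m: "m < n"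
  shows "\<sigma> m = \<tau> m"
proof (cases "m < c")
  case True
  have "\<tau> m < n"
    using \<tau> m bij_betw_apply[of \<tau> "{0..<n}" "{0..<n}" m] unfolding involutive_permutation_def by simp
  then have "\<sigma> (\<tau> m) = m" using eq up True m \<tau> unfolding involutive_permutation_def by simp
  moreover have "\<sigma> (\<sigma> (\<tau> m)) = \<tau> m" using \<sigma> \<open>\<tau> m < n\<close> unfolding involutive_permutation_def by simp
  ultimately show ?thesis by simp
qed (use eq m in simp)

text \<open>In (C), being determined by a part means that any involutive permutation agreeing with
  the sequence there is the whole column. In (B), both sequences are chosen before
  \<open>k\<close>.\<close>

theorem theorem14:
  shows
    "(\<forall>k>1. \<forall>i \<in> {1..k - 1} \<union> {k + 1}. \<forall>\<alpha>. is_germ k \<alpha> \<longrightarrow>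
        entry (neighbor k \<alpha> (i - 1)) (j_pos k (i - 1)) = entry \<alpha> (j_pos k (i - 1)))
     \<and>
     (\<exists>R0 :: nat \<Rightarrow> nat list. \<exists>S0 :: nat \<Rightarrow> nat. \<forall>k>1.
        (\<forall>m<catalan k. rgs (CAT k m k) = R0 m) \<and>
        (\<forall>m<catalan k. CAT_column k k m = S0 m) \<and>
        involutive_permutation (catalan k) S0)
     \<and>
     (\<exists>S1 :: nat \<Rightarrow> nat. is_S1 S1 \<and>
        (\<forall>k>2. involutive_permutation (catalan k) (CAT_column k (k - 1)) \<and>
          (\<forall>\<sigma>. involutive_permutation (catalan k) \<sigma> \<and>
                (\<forall>m \<in> {catalan (k - 1)..<catalan k}. \<sigma> m = S1 m)
             \<longrightarrow> (\<forall>m<catalan k. \<sigma> m = CAT_column k (k - 1) m))))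
     \<and>
     (\<forall>k>1. involutive_permutation (catalan k) (CAT_column k (k - 1)) \<and>
        (\<forall>m<catalan k. CAT_column (k + 1) (k - 1) m = CAT_column k (k - 1) m))"
proof (intro conjI)
  show "\<forall>k>1. \<forall>i \<in> {1..k - 1} \<union> {k + 1}. \<forall>\<alpha>. is_germ k \<alpha> \<longrightarrow>
      entry (neighbor k \<alpha> (i - 1)) (j_pos k (i - 1)) = entry \<alpha> (j_pos k (i - 1))"
  proof (intro allI impI ballI)
    fix k i \<alpha> assume k: "1 < k" and i: "i \<in> {1..k - 1} \<union> {k + 1}" and \<alpha>: "is_germ k \<alpha>"
    show "entry (neighbor k \<alpha> (i - 1)) (j_pos k (i - 1)) = entry \<alpha> (j_pos k (i - 1))"
    proof (cases "i = k + 1")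
      case True
      then show ?thesis using neighbor_top_preserves_entry[OF \<alpha>] by (simp add: j_pos_def)
    next
      case False
      then have "i - 1 < k - 1" "i - 1 \<noteq> k" using i by auto
      then show ?thesis using neighbor_preserves_entry[OF \<alpha>] by (simp add: j_pos_def)
    qed
  qed
next
  let ?S0 = "\<lambda>m. CAT_column (least_table m) (least_table m) m"
  let ?R0 = "\<lambda>m. rgs (CAT (least_table m) m (least_table m))"
  have "(\<forall>m<catalan k. rgs (CAT k m k) = ?R0 m) \<and> (\<forall>m<catalan k. CAT_column k k m = ?S0 m) \<and>
      involutive_permutation (catalan k) ?S0" if k: "1 < k" for k
  proof -
    have S0: "CAT_column k k m = ?S0 m" if "m < catalan k" for m
      by (rule compatible_family[where f = "\<lambda>k. CAT_column k k", OF CAT_top_Suc(2) k that])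
    have "rgs (CAT (Suc k) m (Suc k)) = rgs (CAT k m k)" if "1 < k" "m < catalan k" for k m
    proof -
      have "is_germ k (CAT k m k)" unfolding CAT_def by (rule is_germ_neighbor[OF germ_at(1)[OF that]]) simp
      then have "CAT k m k \<noteq> []" by (auto simp: is_germ_iff)
      then show ?thesis unfolding CAT_top_Suc(1)[OF that] by (rule rgs_Cons_0)
    qed
    then have R0: "rgs (CAT k m k) = ?R0 m" if "m < catalan k" for m
      by (rule compatible_family[where f = "\<lambda>k m. rgs (CAT k m k)", OF _ k that])
    have "involutive_permutation (catalan k) ?S0"
      by (rule involutive_permutation_cong[OF involutive_permutation_CAT_column[OF k order_refl] S0])
    then show ?thesis using S0 R0 by blast
  qed
  then show "\<exists>R0 S0. \<forall>k>1. (\<forall>m<catalan k. rgs (CAT k m k) = R0 m) \<and>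
      (\<forall>m<catalan k. CAT_column k k m = S0 m) \<and> involutive_permutation (catalan k) S0"
    by (intro exI[of _ ?R0] exI[of _ ?S0]) blast
next
  have "\<sigma> m = CAT_column k (k - 1) m"
    if "2 < k" "involutive_permutation (catalan k) \<sigma>"
      "\<forall>m \<in> {catalan (k - 1)..<catalan k}. \<sigma> m = S1_seq m" "m < catalan k" for k \<sigma> m
  proof (rule involution_determined[OF that(2)])
    show "involutive_permutation (catalan k) (CAT_column k (k - 1))"
      using that(1) by (intro involutive_permutation_CAT_column) auto
    show "\<forall>m \<in> {catalan (k - 1)..<catalan k}. \<sigma> m = CAT_column k (k - 1) m"
      using that(3) least_table_eq[OF that(1)] by (simp add: S1_seq_def)
  qed (use that CAT_column_subtop_ge[OF that(1)] in auto)
  then show "\<exists>S1. is_S1 S1 \<and>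
      (\<forall>k>2. involutive_permutation (catalan k) (CAT_column k (k - 1)) \<and>
        (\<forall>\<sigma>. involutive_permutation (catalan k) \<sigma> \<and>
            (\<forall>m \<in> {catalan (k - 1)..<catalan k}. \<sigma> m = S1 m) \<longrightarrow>
          (\<forall>m<catalan k. \<sigma> m = CAT_column k (k - 1) m)))"
    using is_S1_S1_seq involutive_permutation_CAT_column by (intro exI[of _ S1_seq]) simp
next
  show "\<forall>k>1. involutive_permutation (catalan k) (CAT_column k (k - 1)) \<and>
      (\<forall>m<catalan k. CAT_column (k + 1) (k - 1) m = CAT_column k (k - 1) m)"
    using involutive_permutation_CAT_column CAT_column_subtop_Suc by simp
qed

end
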